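(* Let $d,N,L\ge1$ be integers with $N\ge L-1$ and let $T>0$. Let $A_1,\dots,A_d\in\mathbb{R}^{N\times N}$ be random matrices and $D_1,\dots,D_d\in\mathbb{R}^{N\times N}$ random diagonal matrices, such that all entries of the $A_i$ and all diagonal entries of the $D_i$ are sampled independently according to a distribution that is absolutely continuous with respect to the Lebesgue measure on $\mathbb{R}$. Define $$V_i(x)=\exp(A_i\exp(D_ix)),\qquad x\in\mathbb{R}^N,\ i=1,\dots,d,$$ where $\exp$ is applied componentwise to vectors. For a Lipschitz continuous path $X:[0,T]\to\mathbb{R}^d$ and $y\in\mathbb{R}^N$ let $Y^y:[0,T]\to\mathbb{R}^N$ denote the unique solution of $$Y_t=y+\sum_{i=1}^d\int_0^tV_i(Y_s)\,dX^i_s,\qquad t\in[0,T].$$ Then, almost surely, the signature components up to order $L$ of $X$ can be uniquely reconstructed from the randomized signature with depth two $(Y^y)_{y\in\mathbb{R}^N}$. That is, almost surely: if $X$ and $\tilde X$ are Lipschitz continuous paths $[0,T]\to\mathbb{R}^d$ whose associated solutions satisfy $Y^y_t=\tilde Y^y_t$ for all $y\in\mathbb{R}^N$ and $t\in[0,T]$, then for every $m\le L$, every word $w\in\{1,\dots,d\}^m$ and all $0\le s\le t\le T$ the iterated integrals $\int_{\Delta^m_{[s,t]}}dX^w_r$ and $\int_{\Delta^m_{[s,t]}}d\tilde X^w_r$ coincide.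
   Context: For a Lipschitz path $X=(X^1,\dots,X^d):[0,T]\to\mathbb{R}^d$, a word $w=(w_1,\dots,w_m)\in\{1,\dots,d\}^m$ and $0\le s\le t\le T$, $$\int_{\Delta^m_{[s,t]}}dX^w_r:=\int_s^t\int_s^{r_m}\cdots\int_s^{r_2}dX^{w_1}_{r_1}\,dX^{w_2}_{r_2}\cdots dX^{w_m}_{r_m}.$$ The $m$-th order signature component of $X$ is the collection of these integrals over all words of length $m$. Standing assumption: the paths considered are such that for every $y\in\mathbb{R}^N$ the controlled differential equation has a unique solution on all of $[0,T]$. *)

theory Defs
  imports "HOL-Probability.Probability"
begin

text \<open>Riemann--Stieltjes integral of \<open>f\<close> against \<open>g\<close> over \<open>[a, b]\<close>: limit of Riemann--Stieltjes
  sums as the mesh of the tagged partition tends to zero. It exists and is unique for continuous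
  \<open>f\<close> and Lipschitz \<open>g\<close>.\<close>

definition has_RS_integral ::
    "(real \<Rightarrow> 'b::real_normed_vector) \<Rightarrow> (real \<Rightarrow> real) \<Rightarrow> real \<Rightarrow> real \<Rightarrow> 'b \<Rightarrow> bool" where
  "has_RS_integral f g a b I \<longleftrightarrow>
     (\<forall>e>0. \<exists>\<delta>>0. \<forall>p. p tagged_division_of {a..b} \<and> (\<forall>(x, K)\<in>p. Sup K - Inf K < \<delta>) \<longrightarrow>
        norm ((\<Sum>(x, K)\<in>p. (g (Sup K) - g (Inf K)) *\<^sub>R f x) - I) < e)"

definition RS_integral ::
    "real \<Rightarrow> real \<Rightarrow> (real \<Rightarrow> 'b::real_normed_vector) \<Rightarrow> (real \<Rightarrow> real) \<Rightarrow> 'b" where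
  "RS_integral a b f g = (THE I. has_RS_integral f g a b I)"

lemma has_RS_integral_unique:
  assumes I: "has_RS_integral f g a b I" and J: "has_RS_integral f g a b J"
  shows "I = J"
proof (rule ccontr)
  assume "I \<noteq> J"
  then have e: "norm (I - J) / 2 > 0" by simp
  obtain d1 where d1: "d1 > 0"
    "\<And>p. p tagged_division_of {a..b} \<Longrightarrow> \<forall>(x, K)\<in>p. Sup K - Inf K < d1 \<Longrightarrow>
        norm ((\<Sum>(x, K)\<in>p. (g (Sup K) - g (Inf K)) *\<^sub>R f x) - I) < norm (I - J) / 2"
    using I e unfolding has_RS_integral_def by meson
  obtain d2 where d2: "d2 > 0"
    "\<And>p. p tagged_division_of {a..b} \<Longrightarrow> \<forall>(x, K)\<in>p. Sup K - Inf K < d2 \<Longrightarrow>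
        norm ((\<Sum>(x, K)\<in>p. (g (Sup K) - g (Inf K)) *\<^sub>R f x) - J) < norm (I - J) / 2"
    using J e unfolding has_RS_integral_def by meson
  define \<delta> where "\<delta> = min d1 d2 / 2"
  have \<delta>: "\<delta> > 0" "2 * \<delta> \<le> d1" "2 * \<delta> \<le> d2" using d1(1) d2(1) by (auto simp: \<delta>_def)
  have "gauge (\<lambda>x::real. ball x \<delta>)" using \<delta>(1) by (rule gauge_ball)
  then obtain p where p: "p tagged_division_of (cbox a b)" and fine: "(\<lambda>x. ball x \<delta>) fine p"
    using fine_division_exists by blast
  have mesh: "Sup K - Inf K < 2 * \<delta>" if xK: "(x, K) \<in> p" for x K
  proof -
    obtain u v where K: "K = cbox u v" using p xK by (meson tagged_division_ofD(4))
    have "x \<in> K" using p xK by (meson tagged_division_ofD(2))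
    then have uv: "u \<le> v" using K by auto
    have "K \<subseteq> ball x \<delta>" using fine xK by (auto simp: fine_def)
    then have "dist x u < \<delta>" "dist x v < \<delta>" using uv K by auto
    then show ?thesis using uv K by (auto simp: dist_real_def)
  qed
  let ?S = "\<Sum>(x, K)\<in>p. (g (Sup K) - g (Inf K)) *\<^sub>R f x"
  have p': "p tagged_division_of {a..b}" using p by (simp add: cbox_interval)
  have m1: "\<forall>(x, K)\<in>p. Sup K - Inf K < d1" and m2: "\<forall>(x, K)\<in>p. Sup K - Inf K < d2"
    using mesh \<delta> by fastforce+
  have "norm (I - J) \<le> norm (?S - I) + norm (?S - J)"
    using norm_triangle_ineq4[of "?S - J" "?S - I"] by simp
  also have "\<dots> < norm (I - J)" using d1(2)[OF p' m1] d2(2)[OF p' m2] by linarith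
  finally show False by simp
qed

lemma RS_integral_eq: "has_RS_integral f g a b I \<Longrightarrow> RS_integral a b f g = I"
  unfolding RS_integral_def by (rule the_equality) (auto intro: has_RS_integral_unique)

text \<open>The outermost integration is against the last letter of the word, so the recursion runs over
  the reversed word.\<close>

primrec iterated_integral_rev ::
    "(real \<Rightarrow> real ^ 'd) \<Rightarrow> 'd list \<Rightarrow> real \<Rightarrow> real \<Rightarrow> real" where
  "iterated_integral_rev X [] s t = 1"
| "iterated_integral_rev X (i # v) s t =
     RS_integral s t (\<lambda>r. iterated_integral_rev X v s r) (\<lambda>r. X r $ i)"

definition iterated_integral ::
    "(real \<Rightarrow> real ^ 'd) \<Rightarrow> 'd list \<Rightarrow> real \<Rightarrow> real \<Rightarrow> real" where
  "iterated_integral X w s t = iterated_integral_rev X (rev w) s t"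

definition vec_exp :: "real ^ 'n \<Rightarrow> real ^ 'n" where
  "vec_exp x = (\<chi> j. exp (x $ j))"

definition vector_field :: "real ^ 'n ^ 'n \<Rightarrow> real ^ 'n ^ 'n \<Rightarrow> real ^ 'n \<Rightarrow> real ^ 'n" where
  "vector_field A D x = vec_exp (A *v vec_exp (D *v x))"

definition cde_solution ::
    "('d \<Rightarrow> real ^ 'n \<Rightarrow> real ^ 'n) \<Rightarrow> (real \<Rightarrow> real ^ 'd) \<Rightarrow> real \<Rightarrow> real ^ 'n
      \<Rightarrow> (real \<Rightarrow> real ^ 'n) \<Rightarrow> bool" where
  "cde_solution V X T y Y \<longleftrightarrow> continuous_on {0..T} Y \<and>
     (\<forall>t\<in>{0..T}. Y t = y + (\<Sum>i\<in>UNIV. RS_integral 0 t (\<lambda>s. V i (Y s)) (\<lambda>s. X s $ i)))"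

text \<open>Paths on \<open>[0, T]\<close> are total functions on the reals whose values outside \<open>[0, T]\<close> are
  irrelevant, hence uniqueness is only meant on \<open>[0, T]\<close>.\<close>

definition cde_unique_solution ::
    "('d \<Rightarrow> real ^ 'n \<Rightarrow> real ^ 'n) \<Rightarrow> (real \<Rightarrow> real ^ 'd) \<Rightarrow> real \<Rightarrow> real ^ 'n
      \<Rightarrow> (real \<Rightarrow> real ^ 'n) \<Rightarrow> bool" where
  "cde_unique_solution V X T y Y \<longleftrightarrow> cde_solution V X T y Y \<and>
     (\<forall>Z. cde_solution V X T y Z \<longrightarrow> (\<forall>t\<in>{0..T}. Z t = Y t))"

text \<open>The family of all sampled scalars: \<open>Inl (i, j, k)\<close> is the \<open>(j, k)\<close> entry of \<open>A\<^sub>i\<close>, and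
  \<open>Inr (i, j)\<close> is the \<open>j\<close>-th diagonal entry of \<open>D\<^sub>i\<close>.\<close>

fun sampled_entry ::
    "('d \<Rightarrow> 'a \<Rightarrow> real ^ 'n ^ 'n) \<Rightarrow> ('d \<Rightarrow> 'a \<Rightarrow> real ^ 'n ^ 'n)
      \<Rightarrow> ('d \<times> 'n \<times> 'n) + ('d \<times> 'n) \<Rightarrow> 'a \<Rightarrow> real" where
  "sampled_entry A D (Inl (i, j, k)) \<omega> = A i \<omega> $ j $ k"
| "sampled_entry A D (Inr (i, j)) \<omega> = D i \<omega> $ j $ j"

end

(* Every iterated integral depends on X only through its increments, so it suffices to show that the
   flow y |-> Y^y determines X up to a constant. By Gronwall, forwards and backwards in
   time, y |-> Y^y_s is continuous and injective, hence its range is open by invariance of domain.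
   If X and X' generate the same flow, then for Z = X - X' and every x in this open set
   sum_i V_i(x)_j (Z^i_t - Z^i_s) = o(t - s). Almost surely the functions x |-> V_i(x)_j,
   i = 1, ..., d, are linearly independent on every open set, so Z has derivative 0 everywhere.
   Linear independence: on a line in direction j they are constants times exp(a_i exp(D_i r)), which
   extend to entire functions of r, and on a suitable horizontal ray the one with the largest |D_i|
   dominates all the others; almost surely all a_i and D_i are nonzero and the |D_i| distinct. *)

theory Submission
  imports Defs "HOL-Complex_Analysis.Conformal_Mappings" "HOL-Real_Asymp.Real_Asymp"
begin

subsection \<open>Riemann--Stieltjes integrals\<close>

text \<open>Two obstacles shape the argument. The fields \<open>vector_field A D\<close> are in
  general only locally Lipschitz, so every Gronwall constant depends on a radius, and continuity of
  the flow in y first needs an exit-time argument that confines nearby solutions to a common ball.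
  Moreover, at time s the difference Z can be tested only against vectors (V_i(x)_j)_i with x in the
  range of the flow, an open set of unknown position and size. Asymptotics at infinity thus become
  available only after analytic continuation; on the real axis they would not suffice, since a term
  with negative a_i stays below 1 there and the largest |D_i| may belong to such a term. One fixed
  row j is enough: letting x vary over the open set already yields d independent conditions on the d
  components of Z. All estimates for the integrals come from one comparison of sums over two
  different divisions.\<close>

lemma tagged_division_ofD_interval:
  fixes a b :: real
  assumes "p tagged_division_of {a..b}" "(x, K) \<in> p"
  obtains u v where "K = {u..v}" "u \<le> v" "a \<le> u" "v \<le> b" "x \<in> {u..v}" "Inf K = u" "Sup K = v"
proof -
  obtain u v where K: "K = cbox u v" using assms by (meson tagged_division_ofD(4))
  have x: "x \<in> K" "K \<subseteq> {a..b}" using assms by (meson tagged_division_ofD)+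
  then have "u \<le> v" using K by auto
  then show ?thesis using that[of u v] K x by auto
qed

section \<open>Comparison of Riemann-Stieltjes sums over two divisions\<close>

definition mesh_division :: "real \<Rightarrow> real \<Rightarrow> real \<Rightarrow> (real \<times> real set) set \<Rightarrow> bool" where
  "mesh_division a b \<delta> p \<longleftrightarrow> p tagged_division_of {a..b} \<and> (\<forall>(x, K)\<in>p. Sup K - Inf K < \<delta>)"

lemma mesh_divisionD: "mesh_division a b \<delta> p \<Longrightarrow> p tagged_division_of {a..b}"
  by (simp add: mesh_division_def)

lemma mesh_division_mono: "mesh_division a b \<delta> p \<Longrightarrow> \<delta> \<le> \<delta>' \<Longrightarrow> mesh_division a b \<delta>' p"
  unfolding mesh_division_def by fastforce

lemma mesh_division_exists:
  assumes "\<delta> > 0"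
  shows "\<exists>p. mesh_division a b \<delta> p"
proof -
  have "gauge (\<lambda>x::real. ball x (\<delta> / 2))" using assms by (intro gauge_ball) simp
  then obtain p where p: "p tagged_division_of {a..b}" and fine: "(\<lambda>x. ball x (\<delta> / 2)) fine p"
    by (rule fine_division_exists_real)
  have "Sup K - Inf K < \<delta>" if xK: "(x, K) \<in> p" for x K
  proof -
    obtain u v where uv: "K = {u..v}" "u \<le> v" "Inf K = u" "Sup K = v"
      using tagged_division_ofD_interval[OF p xK] by metis
    have "K \<subseteq> ball x (\<delta> / 2)" using fine xK by (auto simp: fine_def)
    then have "dist x u < \<delta> / 2" "dist x v < \<delta> / 2" using uv by auto
    then have "v - u < \<delta>" using uv(2) unfolding dist_real_def by linarith
    then show ?thesis using uv by simp
  qed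
  with p show ?thesis unfolding mesh_division_def by blast
qed

text \<open>For intervals this is the increment of \<open>g\<close> over the intersection of
  \<open>K\<close> and \<open>K'\<close>, and 0 if they are disjoint. It allows two divisions to be
  compared without constructing their common refinement.\<close>

definition overlap_increment :: "(real \<Rightarrow> real) \<Rightarrow> real set \<Rightarrow> real set \<Rightarrow> real" where
  "overlap_increment g K K' = (if max (Inf K) (Inf K') \<le> min (Sup K) (Sup K')
     then g (min (Sup K) (Sup K')) - g (max (Inf K) (Inf K')) else 0)"

lemma overlap_increment_commute: "overlap_increment g K K' = overlap_increment g K' K"
  by (simp add: overlap_increment_def max.commute min.commute)

lemma sum_overlap_increment:
  fixes a b u v :: real
  assumes q: "q tagged_division_of {a..b}" and uv: "a \<le> u" "u \<le> v" "v \<le> b"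
  shows "(\<Sum>(y, K')\<in>q. overlap_increment g {u..v} K') = g v - g u"
proof -
  \<comment> \<open>Precomposing \<open>g\<close> with the clamp onto \<open>{u..v}\<close> turns
    each overlap increment into an ordinary increment over \<open>K'\<close>, so the sum telescopes
    along \<open>q\<close>.\<close>
  define G where "G x = g (max u (min v x))" for x
  have "(\<Sum>(y, K')\<in>q. overlap_increment g {u..v} K') = (\<Sum>(y, K')\<in>q. G (Sup K') - G (Inf K'))"
  proof (rule sum.cong[OF refl], clarify)
    fix y K' assume "(y, K') \<in> q"
    then obtain u' v' where "u' \<le> v'" "Inf K' = u'" "Sup K' = v'"
      using tagged_division_ofD_interval[OF q] by metis
    then show "overlap_increment g {u..v} K' = G (Sup K') - G (Inf K')"
      using uv by (auto simp: overlap_increment_def G_def max_def min_def)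
  qed
  also have "\<dots> = G b - G a"
    using uv by (intro additive_tagged_division_1 q) auto
  also have "\<dots> = g v - g u"
  proof -
    have "max u (min v b) = v" "max u (min v a) = u" using uv by auto
    then show ?thesis by (simp add: G_def)
  qed
  finally show ?thesis .
qed

definition RS_sum :: "(real \<Rightarrow> 'b::real_normed_vector) \<Rightarrow> (real \<Rightarrow> real) \<Rightarrow> (real \<times> real set) set \<Rightarrow> 'b" where
  "RS_sum f g p = (\<Sum>(x, K)\<in>p. (g (Sup K) - g (Inf K)) *\<^sub>R f x)"

lemma RS_sum_overlap:
  assumes p: "p tagged_division_of {a..b}" and q: "q tagged_division_of {a..b}"
  shows "RS_sum f g p = (\<Sum>(x, K)\<in>p. \<Sum>(y, K')\<in>q. overlap_increment g K K' *\<^sub>R f x)"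
  unfolding RS_sum_def
proof (rule sum.cong[OF refl], clarify)
  fix x K assume "(x, K) \<in> p"
  then obtain u v where uv: "K = {u..v}" "u \<le> v" "a \<le> u" "v \<le> b"
    using tagged_division_ofD_interval[OF p] by metis
  have "g (Sup K) - g (Inf K) = (\<Sum>(y, K')\<in>q. overlap_increment g K K')"
    using uv sum_overlap_increment[OF q, of u v g] by simp
  then show "(g (Sup K) - g (Inf K)) *\<^sub>R f x = (\<Sum>(y, K')\<in>q. overlap_increment g K K' *\<^sub>R f x)"
    by (simp add: scaleR_sum_left case_prod_unfold)
qed

text \<open>Both sums become double sums over pairs of blocks with the same weights, so their
  difference only involves \<open>f x - f y\<close> for tags of blocks that meet; all other pairs
  have weight 0. Each weight is at most \<open>C\<close> times the length of the overlap, and these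
  lengths add up to \<open>b - a\<close>.\<close>

lemma RS_sum_compare:
  assumes p: "p tagged_division_of {a..b}" and q: "q tagged_division_of {a..b}"
    and ab: "a \<le> b" and g: "C-lipschitz_on {a..b} g"
    and f: "\<And>x K y K'. (x, K) \<in> p \<Longrightarrow> (y, K') \<in> q \<Longrightarrow> K \<inter> K' \<noteq> {} \<Longrightarrow> norm (f x - f y) \<le> e"
  shows "norm (RS_sum f g p - RS_sum f g q) \<le> e * (C * (b - a))"
proof -
  let ?o = "overlap_increment g" and ?l = "overlap_increment (\<lambda>x. x)"
  have 1: "RS_sum f g p = (\<Sum>(x, K)\<in>p. \<Sum>(y, K')\<in>q. ?o K K' *\<^sub>R f x)"
    by (rule RS_sum_overlap[OF p q])
  have "RS_sum f g q = (\<Sum>(y, K')\<in>q. \<Sum>(x, K)\<in>p. ?o K' K *\<^sub>R f y)"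
    by (rule RS_sum_overlap[OF q p])
  also have "\<dots> = (\<Sum>(x, K)\<in>p. \<Sum>(y, K')\<in>q. ?o K K' *\<^sub>R f y)"
    unfolding case_prod_unfold by (subst sum.swap) (simp add: overlap_increment_commute)
  finally have "RS_sum f g p - RS_sum f g q
      = (\<Sum>(x, K)\<in>p. \<Sum>(y, K')\<in>q. ?o K K' *\<^sub>R (f x - f y))"
    unfolding 1 by (simp add: sum_subtractf[symmetric] case_prod_unfold scaleR_diff_right)
  also have "norm \<dots> \<le> (\<Sum>(x, K)\<in>p. \<Sum>(y, K')\<in>q. e * (C * ?l K K'))"
    unfolding case_prod_unfold
  proof (intro sum_norm_le)
    fix i j assume "i \<in> p" "j \<in> q"
    then obtain x K y K' where ij: "i = (x, K)" "j = (y, K')" "(x, K) \<in> p" "(y, K') \<in> q"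
      by (metis surj_pair)
    obtain u v where uv: "K = {u..v}" "u \<le> v" "a \<le> u" "v \<le> b"
      using tagged_division_ofD_interval[OF p ij(3)] by metis
    obtain u' v' where uv': "K' = {u'..v'}" "u' \<le> v'" "a \<le> u'" "v' \<le> b"
      using tagged_division_ofD_interval[OF q ij(4)] by metis
    have "norm (?o K K' *\<^sub>R (f x - f y)) \<le> e * (C * ?l K K')"
    proof (cases "max u u' \<le> min v v'")
      case True
      then have "max u u' \<in> K \<inter> K'" using uv uv' by auto
      then have e: "norm (f x - f y) \<le> e" using f ij by blast
      have "\<bar>g (min v v') - g (max u u')\<bar> \<le> C * (min v v' - max u u')"
        using lipschitz_onD[OF g, of "min v v'" "max u u'"] True uv uv'
        by (auto simp: dist_real_def abs_of_nonneg)
      then have "\<bar>?o K K'\<bar> \<le> C * ?l K K'" using True uv uv' by (simp add: overlap_increment_def)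
      then have "\<bar>?o K K'\<bar> * norm (f x - f y) \<le> (C * ?l K K') * e"
        using e by (intro mult_mono) auto
      then show ?thesis by (simp add: mult_ac)
    next
      case False
      then have "?o K K' = 0" "?l K K' = 0"
        using uv uv' by (auto simp: overlap_increment_def simp del: max.bounded_iff min.bounded_iff)
      then show ?thesis by simp
    qed
    then show "norm (?o (snd i) (snd j) *\<^sub>R (f (fst i) - f (fst j))) \<le> e * (C * ?l (snd i) (snd j))"
      by (simp add: ij)
  qed
  \<comment> \<open>The overlap lengths are again a double sum as in \<open>RS_sum_overlap\<close>,
    now for the constant integrand 1 and the identity as integrator; hence their total is the length
    of the whole interval.\<close>
  also have "\<dots> = e * (C * (\<Sum>(x, K)\<in>p. \<Sum>(y, K')\<in>q. ?l K K' *\<^sub>R 1))"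
    by (simp add: sum_distrib_left case_prod_unfold)
  also have "(\<Sum>(x, K)\<in>p. \<Sum>(y, K')\<in>q. ?l K K' *\<^sub>R 1) = RS_sum (\<lambda>_. 1) (\<lambda>x. x) p"
    by (rule RS_sum_overlap[OF p q, symmetric])
  also have "\<dots> = b - a"
    using additive_tagged_division_1[OF ab p, of "\<lambda>x. x"] by (simp add: RS_sum_def)
  finally show ?thesis .
qed

lemma has_RS_integral_altdef:
  "has_RS_integral f g a b I \<longleftrightarrow>
     (\<forall>e>0. \<exists>\<delta>>0. \<forall>p. mesh_division a b \<delta> p \<longrightarrow> norm (RS_sum f g p - I) < e)"
  by (simp add: has_RS_integral_def RS_sum_def mesh_division_def)

lemma has_RS_integralD:
  assumes "has_RS_integral f g a b I" "e > 0"
  obtains \<delta> where "\<delta> > 0" "\<And>p. mesh_division a b \<delta> p \<Longrightarrow> norm (RS_sum f g p - I) < e"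
  using assms unfolding has_RS_integral_altdef by blast

lemma has_RS_integral_exists:
  fixes f :: "real \<Rightarrow> 'b::banach"
  assumes ab: "a \<le> b" and f: "continuous_on {a..b} f" and g: "C-lipschitz_on {a..b} g"
  shows "\<exists>I. has_RS_integral f g a b I"
proof -
  have C: "C \<ge> 0" using g by (rule lipschitz_on_nonneg)
  have cauchy: "\<exists>\<delta>>0. \<forall>p q. mesh_division a b \<delta> p \<longrightarrow> mesh_division a b \<delta> q \<longrightarrow> norm (RS_sum f g p - RS_sum f g q) < e"
    if "e > 0" for e
  proof -
    \<comment> \<open>The summand 1 keeps the denominator positive when \<open>C * (b - a)\<close>
      vanishes.\<close>
    define e' where "e' = (e / 2) / (C * (b - a) + 1)"
    have Cab: "C * (b - a) \<ge> 0" using C ab by simp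
    have pos: "e' > 0" using Cab that by (simp add: e'_def)
    have "C * (b - a) + 1 \<noteq> 0" using Cab by linarith
    then have "e' * (C * (b - a) + 1) = e / 2"
      unfolding e'_def by (rule nonzero_eq_divide_eq[THEN iffD1, OF _ refl])
    then have "e' * (C * (b - a)) < e" using pos that by (simp add: distrib_left)
    note e' = pos this
    have "uniformly_continuous_on {a..b} f"
      using f by (intro compact_uniformly_continuous) auto
    then obtain d where d: "d > 0"
      "\<And>x y. x \<in> {a..b} \<Longrightarrow> y \<in> {a..b} \<Longrightarrow> dist y x < d \<Longrightarrow> dist (f y) (f x) < e'"
      using e'(1) unfolding uniformly_continuous_on_def by meson
    \<comment> \<open>Two blocks that meet, each shorter than d/2, have tags less than d
      apart.\<close>
    have "norm (RS_sum f g p - RS_sum f g q) < e" if p: "mesh_division a b (d/2) p" and q: "mesh_division a b (d/2) q" for p q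
    proof -
      have "norm (RS_sum f g p - RS_sum f g q) \<le> e' * (C * (b - a))"
      proof (rule RS_sum_compare)
        fix x K y K' assume xK: "(x, K) \<in> p" and yK': "(y, K') \<in> q" and ne: "K \<inter> K' \<noteq> {}"
        have "p tagged_division_of {a..b}" "q tagged_division_of {a..b}"
          using p q by (auto simp: mesh_division_def)
        then obtain u v u' v' where *: "K = {u..v}" "a \<le> u" "v \<le> b" "x \<in> {u..v}" "Inf K = u" "Sup K = v"
          "K' = {u'..v'}" "a \<le> u'" "v' \<le> b" "y \<in> {u'..v'}" "Inf K' = u'" "Sup K' = v'"
          using tagged_division_ofD_interval xK yK' by metis
        have "v - u < d/2" "v' - u' < d/2" using p q xK yK' * unfolding mesh_division_def by fastforce+
        then have "dist y x < d" using * ne by (auto simp: dist_real_def)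
        then show "norm (f x - f y) \<le> e'" using d(2)[of y x] * by (simp add: dist_norm dist_commute less_imp_le)
      qed (use p q g ab in \<open>auto simp: mesh_division_def\<close>)
      then show ?thesis using e' by simp
    qed
    then show ?thesis using d(1) by (intro exI[of _ "d/2"]) auto
  qed
  have "\<exists>p. mesh_division a b (1 / real (Suc n)) p" for n
    by (rule mesh_division_exists) simp
  then obtain P where P: "\<And>n. mesh_division a b (1 / real (Suc n)) (P n)" by metis
  have P': "\<exists>N. \<forall>n\<ge>N. mesh_division a b \<delta> (P n)" if "\<delta> > 0" for \<delta>
  proof -
    obtain N where N: "1 / real (Suc N) < \<delta>" using nat_approx_posE[OF \<open>\<delta> > 0\<close>] by blast
    have "mesh_division a b \<delta> (P n)" if "n \<ge> N" for n
    proof (rule mesh_division_mono[OF P[of n]])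
      have "1 / real (Suc n) \<le> 1 / real (Suc N)" using that by (intro divide_left_mono) auto
      then show "1 / real (Suc n) \<le> \<delta>" using N by simp
    qed
    then show ?thesis by blast
  qed
  have "Cauchy (\<lambda>n. RS_sum f g (P n))"
    unfolding Cauchy_iff
  proof (intro allI impI)
    fix e :: real assume "e > 0"
    then obtain \<delta> where \<delta>: "\<delta> > 0"
      "\<forall>p q. mesh_division a b \<delta> p \<longrightarrow> mesh_division a b \<delta> q \<longrightarrow> norm (RS_sum f g p - RS_sum f g q) < e"
      using cauchy by blast
    obtain N where "\<forall>n\<ge>N. mesh_division a b \<delta> (P n)" using P'[OF \<delta>(1)] by blast
    then show "\<exists>M. \<forall>m\<ge>M. \<forall>n\<ge>M. norm (RS_sum f g (P m) - RS_sum f g (P n)) < e"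
      using \<delta>(2) by blast
  qed
  then obtain I where I: "(\<lambda>n. RS_sum f g (P n)) \<longlonglongrightarrow> I"
    using Cauchy_convergent convergent_def by blast
  have "\<exists>\<delta>>0. \<forall>p. mesh_division a b \<delta> p \<longrightarrow> norm (RS_sum f g p - I) < e" if "e > 0" for e
  proof -
    obtain \<delta> where \<delta>: "\<delta> > 0" "\<And>p q. mesh_division a b \<delta> p \<Longrightarrow> mesh_division a b \<delta> q \<Longrightarrow> norm (RS_sum f g p - RS_sum f g q) < e/2"
      using cauchy[of "e/2"] \<open>e > 0\<close> by (meson half_gt_zero)
    obtain N where N: "\<And>n. n \<ge> N \<Longrightarrow> mesh_division a b \<delta> (P n)" using P' \<delta>(1) by blast
    have "norm (RS_sum f g p - I) < e" if p: "mesh_division a b \<delta> p" for p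
    proof -
      have "(\<lambda>n. norm (RS_sum f g p - RS_sum f g (P n))) \<longlonglongrightarrow> norm (RS_sum f g p - I)"
        by (intro tendsto_intros I)
      then have "norm (RS_sum f g p - I) \<le> e/2"
        by (rule LIMSEQ_le_const2) (use \<delta>(2)[OF p N] in \<open>auto intro: less_imp_le\<close>)
      then show ?thesis using \<open>e > 0\<close> by simp
    qed
    then show ?thesis using \<delta>(1) by blast
  qed
  then show ?thesis unfolding has_RS_integral_altdef by blast
qed

text \<open>Fine divisions are compared with the trivial division \<open>{(c, {a..b})}\<close>,
  whose sum is exactly \<open>(g b - g a) *\<^sub>R f c\<close>. For continuous \<open>f\<close> the
  oscillation \<open>e\<close> shrinks with the interval, so this is the first-order expansion of
  the integral, with error o(b - a).\<close>

lemma has_RS_integral_approx: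
  assumes I: "has_RS_integral f g a b I" and c: "c \<in> {a..b}" and g: "C-lipschitz_on {a..b} g"
    and f: "\<And>x. x \<in> {a..b} \<Longrightarrow> norm (f x - f c) \<le> e"
  shows "norm (I - (g b - g a) *\<^sub>R f c) \<le> e * (C * (b - a))"
proof (rule field_le_epsilon)
  fix \<epsilon> :: real assume "\<epsilon> > 0"
  then obtain \<delta> where \<delta>: "\<delta> > 0" "\<And>p. mesh_division a b \<delta> p \<Longrightarrow> norm (RS_sum f g p - I) < \<epsilon>"
    using has_RS_integralD[OF I \<open>\<epsilon> > 0\<close>] by blast
  obtain p where pm: "mesh_division a b \<delta> p" using mesh_division_exists[OF \<delta>(1)] ..
  note p = mesh_divisionD[OF pm]
  have "norm (RS_sum f g p - RS_sum f g {(c, {a..b})}) \<le> e * (C * (b - a))"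
  proof (rule RS_sum_compare[OF p _ _ g])
    show "{(c, {a..b})} tagged_division_of {a..b}" using c by (rule tagged_division_of_self_real)
    fix x K y K' assume "(x, K) \<in> p" "(y, K') \<in> {(c, {a..b})}"
    moreover from this have "x \<in> {a..b}" using tagged_division_ofD(2,3)[OF p] by blast
    ultimately show "norm (f x - f y) \<le> e" using f by auto
  qed (use c in auto)
  also have "RS_sum f g {(c, {a..b})} = (g b - g a) *\<^sub>R f c" using c by (simp add: RS_sum_def)
  finally have "norm (RS_sum f g p - (g b - g a) *\<^sub>R f c) \<le> e * (C * (b - a))" .
  moreover have "norm (I - (g b - g a) *\<^sub>R f c)
      \<le> norm (RS_sum f g p - (g b - g a) *\<^sub>R f c) + norm (RS_sum f g p - I)"
    using norm_triangle_ineq4[of "RS_sum f g p - (g b - g a) *\<^sub>R f c" "RS_sum f g p - I"] by simp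
  ultimately show "norm (I - (g b - g a) *\<^sub>R f c) \<le> e * (C * (b - a)) + \<epsilon>"
    using \<delta>(2)[OF pm] by simp
qed

lemma has_RS_integral_bound:
  assumes I: "has_RS_integral f g a b I" and ab: "a \<le> b" and g: "C-lipschitz_on {a..b} g"
    and f: "\<And>x. x \<in> {a..b} \<Longrightarrow> norm (f x) \<le> B"
  shows "norm I \<le> 3 * B * (C * (b - a))"
proof -
  have "norm (I - (g b - g a) *\<^sub>R f a) \<le> (2 * B) * (C * (b - a))"
  proof (rule has_RS_integral_approx[OF I _ g])
    show "norm (f x - f a) \<le> 2 * B" if "x \<in> {a..b}" for x
      using norm_triangle_ineq4[of "f x" "f a"] f[OF that] f[of a] ab by simp
  qed (use ab in auto)
  moreover have "\<bar>g b - g a\<bar> * norm (f a) \<le> (C * (b - a)) * B"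
    using lipschitz_onD[OF g, of b a] ab f[of a] by (intro mult_mono) (auto simp: dist_real_def lipschitz_on_nonneg[OF g])
  moreover have "norm I \<le> norm (I - (g b - g a) *\<^sub>R f a) + norm ((g b - g a) *\<^sub>R f a)"
    by (metis diff_add_cancel norm_triangle_ineq)
  moreover have "3 * B * (C * (b - a)) = (2 * B) * (C * (b - a)) + (C * (b - a)) * B" by algebra
  ultimately show ?thesis by (simp only: norm_scaleR)
qed

lemma has_RS_integral_diff:
  assumes "has_RS_integral f g a b I" "has_RS_integral f' g a b I'"
  shows "has_RS_integral (\<lambda>x. f x - f' x) g a b (I - I')"
  unfolding has_RS_integral_altdef
proof (intro allI impI)
  fix e :: real assume "e > 0"
  then have e: "e / 2 > 0" by simp
  obtain d where d: "d > 0" "\<And>p. mesh_division a b d p \<Longrightarrow> norm (RS_sum f g p - I) < e / 2"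
    using has_RS_integralD[OF assms(1) e] by blast
  obtain d' where d': "d' > 0" "\<And>p. mesh_division a b d' p \<Longrightarrow> norm (RS_sum f' g p - I') < e / 2"
    using has_RS_integralD[OF assms(2) e] by blast
  have "norm (RS_sum (\<lambda>x. f x - f' x) g p - (I - I')) < e"
    if p: "mesh_division a b (min d d') p" for p
  proof -
    have "norm (RS_sum f g p - I) < e / 2" "norm (RS_sum f' g p - I') < e / 2"
      by (intro d(2) d'(2) mesh_division_mono[OF p]; simp)+
    then have *: "norm ((RS_sum f g p - I) - (RS_sum f' g p - I')) < e"
      using norm_triangle_ineq4[of "RS_sum f g p - I" "RS_sum f' g p - I'"] by linarith
    have "RS_sum (\<lambda>x. f x - f' x) g p = RS_sum f g p - RS_sum f' g p"
      by (simp add: RS_sum_def sum_subtractf[symmetric] case_prod_unfold scaleR_diff_right)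
    then have "RS_sum (\<lambda>x. f x - f' x) g p - (I - I') = (RS_sum f g p - I) - (RS_sum f' g p - I')"
      by simp
    then show ?thesis using * by (simp only:)
  qed
  then show "\<exists>\<delta>>0. \<forall>p. mesh_division a b \<delta> p \<longrightarrow> norm (RS_sum (\<lambda>x. f x - f' x) g p - (I - I')) < e"
    using d(1) d'(1) by (intro exI[of _ "min d d'"]) auto
qed

text \<open>A division of \<open>{a..c}\<close> need not split at \<open>b\<close>; but
  \<open>K\<close> is assumed to be the limit over all fine divisions, so it may be tested on those
  obtained by concatenation.\<close>

lemma has_RS_integral_combine:
  assumes "a \<le> b" "b \<le> c"
    and I: "has_RS_integral f g a b I" and J: "has_RS_integral f g b c J"
    and K: "has_RS_integral f g a c K"
  shows "K = I + J"
proof -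
  have "norm (K - (I + J)) \<le> e" if "e > 0" for e
  proof -
    have e: "e / 3 > 0" using that by simp
    obtain d1 where d1: "d1 > 0" "\<And>p. mesh_division a b d1 p \<Longrightarrow> norm (RS_sum f g p - I) < e / 3"
      using has_RS_integralD[OF I e] by blast
    obtain d2 where d2: "d2 > 0" "\<And>p. mesh_division b c d2 p \<Longrightarrow> norm (RS_sum f g p - J) < e / 3"
      using has_RS_integralD[OF J e] by blast
    obtain d3 where d3: "d3 > 0" "\<And>p. mesh_division a c d3 p \<Longrightarrow> norm (RS_sum f g p - K) < e / 3"
      using has_RS_integralD[OF K e] by blast
    define d where "d = min d1 (min d2 d3)"
    have d: "d > 0" "d \<le> d1" "d \<le> d2" "d \<le> d3" using d1 d2 d3 by (auto simp: d_def)
    obtain p where pm: "mesh_division a b d p" using mesh_division_exists[OF d(1)] ..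
    obtain q where qm: "mesh_division b c d q" using mesh_division_exists[OF d(1)] ..
    note p = mesh_divisionD[OF pm] and q = mesh_divisionD[OF qm]
    have "(p \<union> q) tagged_division_of ({a..b} \<union> {b..c})"
      by (intro tagged_division_Un p q) auto
    moreover have "{a..b} \<union> {b..c} = {a..c}" using assms(1,2) by auto
    ultimately have pq: "mesh_division a c d (p \<union> q)"
      using pm qm by (auto simp: mesh_division_def)
    have "RS_sum f g (p \<union> q) = RS_sum f g p + RS_sum f g q"
      unfolding RS_sum_def
    proof (rule sum.union_inter_neutral)
      show "finite p" "finite q" using p q by auto
      \<comment> \<open>A block belonging to both divisions is the degenerate interval at
        \<open>b\<close>, over which the increment of \<open>g\<close> vanishes.\<close>
      show "\<forall>x\<in>p \<inter> q. (case x of (x, K) \<Rightarrow> (g (Sup K) - g (Inf K)) *\<^sub>R f x) = 0"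
      proof clarify
        fix x K assume xK: "(x, K) \<in> p" "(x, K) \<in> q"
        obtain u v where 1: "K = {u..v}" "u \<le> v" "v \<le> b" "Inf K = u" "Sup K = v"
          using tagged_division_ofD_interval[OF p xK(1)] by metis
        have "b \<le> u" using tagged_division_ofD_interval[OF q xK(2)] 1(4) by metis
        with 1 have "u = v" by linarith
        then show "(g (Sup K) - g (Inf K)) *\<^sub>R f x = 0" using 1 by simp
      qed
    qed
    moreover have "norm (RS_sum f g p - I) < e / 3" by (rule d1(2)[OF mesh_division_mono[OF pm d(2)]])
    moreover have "norm (RS_sum f g q - J) < e / 3" by (rule d2(2)[OF mesh_division_mono[OF qm d(3)]])
    moreover have "norm (RS_sum f g (p \<union> q) - K) < e / 3"
      by (rule d3(2)[OF mesh_division_mono[OF pq d(4)]])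
    ultimately have "norm ((RS_sum f g p - I) + (RS_sum f g q - J) - (RS_sum f g p + RS_sum f g q - K)) \<le> e"
      using norm_triangle_ineq4[of "(RS_sum f g p - I) + (RS_sum f g q - J)" "RS_sum f g p + RS_sum f g q - K"]
        norm_triangle_ineq[of "RS_sum f g p - I" "RS_sum f g q - J"] by simp
    then show ?thesis by (simp add: algebra_simps)
  qed
  then have "norm (K - (I + J)) \<le> 0" by (rule field_le_epsilon) simp
  then show ?thesis by simp
qed

text \<open>Integrators are compared through their increments because the two driving paths will
  only be known to agree up to a constant.\<close>

lemma has_RS_integral_cong:
  assumes f: "\<And>x. x \<in> {a..b} \<Longrightarrow> f x = f' x"
    and g: "\<And>x y. x \<in> {a..b} \<Longrightarrow> y \<in> {a..b} \<Longrightarrow> g x - g y = g' x - g' y"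
  shows "has_RS_integral f g a b I \<longleftrightarrow> has_RS_integral f' g' a b I"
proof -
  have "RS_sum f g p = RS_sum f' g' p" if p: "p tagged_division_of {a..b}" for p
    unfolding RS_sum_def
  proof (rule sum.cong[OF refl], clarify)
    fix x K assume "(x, K) \<in> p"
    then obtain u v where "u \<le> v" "a \<le> u" "v \<le> b" "x \<in> {u..v}" "Inf K = u" "Sup K = v"
      using tagged_division_ofD_interval[OF p] by metis
    then show "(g (Sup K) - g (Inf K)) *\<^sub>R f x = (g' (Sup K) - g' (Inf K)) *\<^sub>R f' x"
      using f[of x] g[of v u] by simp
  qed
  then have "(mesh_division a b \<delta> p \<longrightarrow> norm (RS_sum f g p - I) < e)
      \<longleftrightarrow> (mesh_division a b \<delta> p \<longrightarrow> norm (RS_sum f' g' p - I) < e)" for \<delta> e p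
    using mesh_divisionD by metis
  then show ?thesis unfolding has_RS_integral_altdef by presburger
qed

lemma RS_integral_cong:
  assumes "\<And>x. x \<in> {a..b} \<Longrightarrow> f x = f' x"
    and "\<And>x y. x \<in> {a..b} \<Longrightarrow> y \<in> {a..b} \<Longrightarrow> g x - g y = g' x - g' y"
  shows "RS_integral a b f g = RS_integral a b f' g'"
  unfolding RS_integral_def using has_RS_integral_cong[of a b f f' g g'] assms by presburger

lemma has_RS_integral_increment:
  fixes f :: "real \<Rightarrow> 'b::banach"
  assumes st: "0 \<le> s" "s \<le> t" "t \<le> T" and f: "continuous_on {0..T} f" and g: "C-lipschitz_on {0..T} g"
  shows "has_RS_integral f g s t (RS_integral 0 t f g - RS_integral 0 s f g)"
proof -
  have sub: "\<exists>I. has_RS_integral f g a b I" if "0 \<le> a" "a \<le> b" "b \<le> T" for a b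
    using that by (intro has_RS_integral_exists[where C = C] continuous_on_subset[OF f] lipschitz_on_subset[OF g]) auto
  obtain I J K where *: "has_RS_integral f g 0 s I" "has_RS_integral f g s t J" "has_RS_integral f g 0 t K"
    using sub[of 0 s] sub[of s t] sub[of 0 t] st by auto
  have "K = I + J" using has_RS_integral_combine[OF _ _ *] st by simp
  then show ?thesis using * by (simp add: RS_integral_eq)
qed

lemma iterated_integral_rev_cong:
  assumes "\<And>x y. x \<in> {s..t} \<Longrightarrow> y \<in> {s..t} \<Longrightarrow> X x - X y = X' x - X' y"
  shows "iterated_integral_rev X v s t = iterated_integral_rev X' v s t"
  using assms
\<comment> \<open>The inner integrals end at each \<open>r\<close> in \<open>{s..t}\<close>, so the
  upper limit has to vary in the induction.\<close>
proof (induction v arbitrary: t)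
  case (Cons i v)
  have "X x $ i - X y $ i = X' x $ i - X' y $ i" if "x \<in> {s..t}" "y \<in> {s..t}" for x y
    using Cons.prems[OF that] by (metis vector_minus_component)
  moreover have "iterated_integral_rev X v s r = iterated_integral_rev X' v s r" if "r \<in> {s..t}" for r
    using that by (intro Cons.IH Cons.prems) auto
  ultimately show ?case by (auto intro!: RS_integral_cong)
qed simp

subsection \<open>Openness of the flow\<close>

text \<open>At a point \<open>r\<close> where the norm of \<open>u\<close> is maximal, the increment
  bound gives \<open>norm (u r - u s) \<le> norm (u r) / 2\<close>, hence
  \<open>norm (u r) \<le> 2 * norm (u s)\<close>. The order of \<open>s\<close> and \<open>t\<close>
  is irrelevant, which makes the estimate work backwards in time as well.\<close>

lemma growth_step:
  fixes u :: "real \<Rightarrow> 'b::real_normed_vector"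
  assumes u: "continuous_on {a..b} u"
    and inc: "\<And>s t B. a \<le> s \<Longrightarrow> s \<le> t \<Longrightarrow> t \<le> b \<Longrightarrow> (\<And>r. r \<in> {s..t} \<Longrightarrow> norm (u r) \<le> B)
       \<Longrightarrow> norm (u t - u s) \<le> K * (t - s) * B"
    and K: "K \<ge> 0" "K * (b - a) \<le> 1 / 2" and st: "s \<in> {a..b}" "t \<in> {a..b}"
  shows "norm (u t) \<le> 2 * norm (u s)"
proof -
  have "continuous_on {a..b} (\<lambda>r. norm (u r))" using u by (intro continuous_intros)
  then obtain r where r: "r \<in> {a..b}" "\<And>x. x \<in> {a..b} \<Longrightarrow> norm (u x) \<le> norm (u r)"
    using continuous_attains_sup[of "{a..b}" "\<lambda>r. norm (u r)"] st by auto
  have "norm (u r - u s) \<le> K * \<bar>r - s\<bar> * norm (u r)"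
    using inc[of s r "norm (u r)"] inc[of r s "norm (u r)"] r st
    by (cases "s \<le> r") (auto simp: norm_minus_commute)
  also have "\<dots> \<le> 1 / 2 * norm (u r)"
  proof (rule mult_right_mono)
    have "K * \<bar>r - s\<bar> \<le> K * (b - a)" using K(1) r(1) st by (intro mult_left_mono) auto
    then show "K * \<bar>r - s\<bar> \<le> 1 / 2" using K(2) by linarith
  qed simp
  finally have "norm (u r) \<le> 2 * norm (u s)"
    using norm_triangle_ineq2[of "u r" "u s"] by linarith
  then show ?thesis using r(2)[OF st(2)] by linarith
qed

text \<open>A Gronwall estimate by chaining: the segment between \<open>s\<close> and
  \<open>t\<close> is cut into \<open>n + 1\<close> pieces short enough for
  \<open>growth_step\<close>, and each piece costs a factor 2.\<close>

lemma two_sided_growth: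
  fixes u :: "real \<Rightarrow> 'b::real_normed_vector"
  assumes u: "continuous_on {a..b} u"
    and inc: "\<And>s t B. a \<le> s \<Longrightarrow> s \<le> t \<Longrightarrow> t \<le> b \<Longrightarrow> (\<And>r. r \<in> {s..t} \<Longrightarrow> norm (u r) \<le> B)
       \<Longrightarrow> norm (u t - u s) \<le> K * (t - s) * B"
    and K: "K \<ge> 0" "K * \<bar>t - s\<bar> \<le> (real n + 1) / 2" and st: "s \<in> {a..b}" "t \<in> {a..b}"
  shows "norm (u t) \<le> 2 ^ (n + 1) * norm (u s)"
  using K(2) st(2)
proof (induction n arbitrary: t)
  have step: "norm (u t) \<le> 2 * norm (u m)"
    if "m \<in> {a..b}" "t \<in> {a..b}" "K * \<bar>t - m\<bar> \<le> 1 / 2" for m t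
  proof (rule growth_step[where a = "min m t" and b = "max m t" and K = K])
    show "continuous_on {min m t..max m t} u" using that by (intro continuous_on_subset[OF u]) auto
    show "K * (max m t - min m t) \<le> 1 / 2" using that by (auto simp: max_def min_def)
    fix x y B assume "min m t \<le> x" "x \<le> y" "y \<le> max m t" and B: "\<And>r. r \<in> {x..y} \<Longrightarrow> norm (u r) \<le> B"
    then have "a \<le> x" "y \<le> b" using that by auto
    then show "norm (u y - u x) \<le> K * (y - x) * B" using \<open>x \<le> y\<close> B by (intro inc) auto
  qed (use K in auto)
  {
    case 0
    then show ?case using step[of s t] st by simp
  next
    case (Suc n)
    \<comment> \<open>The point \<open>m\<close> splits the segment in the ratio n + 1 to 1, so that
      the induction hypothesis covers the part from \<open>s\<close> to \<open>m\<close> and a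
      single doubling covers the rest.\<close>
    define l where "l = (real n + 1) / (real n + 2)"
    have l: "0 \<le> l" "l \<le> 1" "l * (real n + 2) = real n + 1" "(1 - l) * (real n + 2) = 1"
      by (auto simp: l_def field_simps)
    define m where "m = s + l * (t - s)"
    have "m = (1 - l) *\<^sub>R s + l *\<^sub>R t" by (simp add: m_def algebra_simps)
    then have m: "m \<in> {a..b}"
      using convexD[OF convex_real_interval(5)[of a b], of s t "1 - l" l] l st Suc.prems(2) by simp
    have *: "K * \<bar>t - s\<bar> \<le> (real n + 2) / 2" using Suc.prems(1) by simp
    have "K * \<bar>m - s\<bar> = l * (K * \<bar>t - s\<bar>)" using l by (simp add: m_def abs_mult)
    also have "\<dots> \<le> l * ((real n + 2) / 2)" using * l(1) by (rule mult_left_mono)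
    also have "\<dots> = (real n + 1) / 2" using l(3) by simp
    finally have 1: "norm (u m) \<le> 2 ^ (n + 1) * norm (u s)" using m by (rule Suc.IH)
    have "t - m = (1 - l) * (t - s)" by (simp add: m_def algebra_simps)
    then have "K * \<bar>t - m\<bar> = (1 - l) * (K * \<bar>t - s\<bar>)" using l by (simp add: abs_mult)
    also have "\<dots> \<le> (1 - l) * ((real n + 2) / 2)" using * l(2) by (intro mult_left_mono) auto
    also have "\<dots> = 1 / 2" using l(4) by simp
    finally have "norm (u t) \<le> 2 * norm (u m)" using m Suc.prems(2) by (intro step) auto
    then show ?case using 1 by simp
  }
qed

section \<open>Increments and stability of solutions\<close>

lemma lipschitz_on_component:
  "C-lipschitz_on U X \<Longrightarrow> C-lipschitz_on U (\<lambda>r. X r $ i)"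
  using dist_vec_nth_le[of "X _" i "X _"] unfolding lipschitz_on_def by (meson order_trans)

lemma cde_solution_increment:
  fixes V :: "'d::finite \<Rightarrow> real ^ 'n \<Rightarrow> real ^ 'n"
  assumes Y: "cde_solution V X T y Y" and X: "C-lipschitz_on {0..T} X"
    and V: "\<And>i. continuous_on UNIV (V i)" and st: "0 \<le> s" "s \<le> t" "t \<le> T"
  obtains J where "\<And>i. has_RS_integral (\<lambda>r. V i (Y r)) (\<lambda>r. X r $ i) s t (J i)"
    "Y t - Y s = (\<Sum>i\<in>UNIV. J i)"
proof -
  define J where "J i = RS_integral 0 t (\<lambda>r. V i (Y r)) (\<lambda>r. X r $ i)
      - RS_integral 0 s (\<lambda>r. V i (Y r)) (\<lambda>r. X r $ i)" for i
  have "continuous_on {0..T} (\<lambda>r. V i (Y r))" for i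
    using Y by (intro continuous_on_compose2[OF V]) (auto simp: cde_solution_def)
  then have "has_RS_integral (\<lambda>r. V i (Y r)) (\<lambda>r. X r $ i) s t (J i)" for i
    unfolding J_def by (rule has_RS_integral_increment[OF st _ lipschitz_on_component[OF X]])
  moreover have "Y t - Y s = (\<Sum>i\<in>UNIV. J i)"
    using Y st by (simp add: cde_solution_def J_def sum_subtractf)
  ultimately show ?thesis by (rule that)
qed

lemma cde_solution_initial:
  fixes V :: "'d::finite \<Rightarrow> real ^ 'n \<Rightarrow> real ^ 'n"
  assumes Y: "cde_solution V X T y Y" and X: "C-lipschitz_on {0..T} X"
    and V: "\<And>i. continuous_on UNIV (V i)" and T: "0 \<le> T"
  shows "Y 0 = y"
proof -
  have "continuous_on {0..T} (\<lambda>r. V i (Y r))" for i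
    using Y by (intro continuous_on_compose2[OF V]) (auto simp: cde_solution_def)
  from has_RS_integral_increment[OF order_refl order_refl T this lipschitz_on_component[OF X]]
  have "RS_integral 0 0 (\<lambda>r. V i (Y r)) (\<lambda>r. X r $ i) = 0" for i
    by (intro RS_integral_eq) simp
  moreover have "Y 0 = y + (\<Sum>i\<in>UNIV. RS_integral 0 0 (\<lambda>r. V i (Y r)) (\<lambda>r. X r $ i))"
    using Y T unfolding cde_solution_def by (meson atLeastAtMost_iff order_refl)
  ultimately show ?thesis by simp
qed

text \<open>Provides the increment hypothesis of \<open>two_sided_growth\<close> for
  \<open>Y - Y'\<close>. The integrands differ by at most \<open>K * B\<close>, and each of the
  CARD('d) driving components contributes the factor \<open>3 * C\<close> from
  \<open>has_RS_integral_bound\<close>.\<close>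

lemma cde_solution_difference:
  fixes V :: "'d::finite \<Rightarrow> real ^ 'n \<Rightarrow> real ^ 'n"
  assumes Y: "cde_solution V X T y Y" and Y': "cde_solution V X T y' Y'"
    and X: "C-lipschitz_on {0..T} X" and V: "\<And>i. continuous_on UNIV (V i)"
    and K: "\<And>i. K-lipschitz_on S (V i)" and S: "\<And>r. r \<in> {s..t} \<Longrightarrow> Y r \<in> S \<and> Y' r \<in> S"
    and st: "0 \<le> s" "s \<le> t" "t \<le> T" and B: "\<And>r. r \<in> {s..t} \<Longrightarrow> norm (Y r - Y' r) \<le> B"
  shows "norm ((Y t - Y' t) - (Y s - Y' s)) \<le> (real CARD('d) * (3 * K * C)) * (t - s) * B"
proof -
  obtain J where J: "\<And>i. has_RS_integral (\<lambda>r. V i (Y r)) (\<lambda>r. X r $ i) s t (J i)"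
    "Y t - Y s = (\<Sum>i\<in>UNIV. J i)"
    using cde_solution_increment[OF Y X V st] by blast
  obtain J' where J': "\<And>i. has_RS_integral (\<lambda>r. V i (Y' r)) (\<lambda>r. X r $ i) s t (J' i)"
    "Y' t - Y' s = (\<Sum>i\<in>UNIV. J' i)"
    using cde_solution_increment[OF Y' X V st] by blast
  have X': "C-lipschitz_on {s..t} (\<lambda>r. X r $ i)" for i
    using st by (intro lipschitz_on_subset[OF lipschitz_on_component[OF X]]) auto
  have "(Y t - Y' t) - (Y s - Y' s) = (\<Sum>i\<in>UNIV. J i - J' i)"
    using J(2) J'(2) by (simp add: sum_subtractf algebra_simps)
  also have "norm \<dots> \<le> (\<Sum>i\<in>(UNIV :: 'd set). 3 * (K * B) * (C * (t - s)))"
  proof (rule sum_norm_le)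
    fix i
    show "norm (J i - J' i) \<le> 3 * (K * B) * (C * (t - s))"
    proof (rule has_RS_integral_bound[OF has_RS_integral_diff[OF J(1) J'(1)] st(2) X'])
      fix r assume r: "r \<in> {s..t}"
      have "norm (V i (Y r) - V i (Y' r)) \<le> K * norm (Y r - Y' r)"
        using lipschitz_onD[OF K] S[OF r] by (simp add: dist_norm)
      also have "\<dots> \<le> K * B" using B[OF r] lipschitz_on_nonneg[OF K] by (rule mult_left_mono)
      finally show "norm (V i (Y r) - V i (Y' r)) \<le> K * B" .
    qed
  qed
  finally show ?thesis by (simp add: algebra_simps)
qed

text \<open>The constant may depend on the radius, as it must for double exponentials, which in
  general are not globally Lipschitz.\<close>

definition lipschitz_on_balls :: "('a::real_normed_vector \<Rightarrow> 'b::real_normed_vector) \<Rightarrow> bool" where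
  "lipschitz_on_balls f \<longleftrightarrow> (\<forall>R. \<exists>K. K-lipschitz_on (cball 0 R) f)"

lemma lipschitz_on_balls_continuous:
  fixes f :: "'a::real_normed_vector \<Rightarrow> 'b::real_normed_vector"
  assumes "lipschitz_on_balls f"
  shows "continuous_on UNIV f"
proof (rule continuous_at_imp_continuous_on, clarify)
  fix x :: 'a
  obtain K where "K-lipschitz_on (cball 0 (norm x + 1)) f"
    using assms unfolding lipschitz_on_balls_def by blast
  then have "continuous_on (ball 0 (norm x + 1)) f"
    by (meson lipschitz_on_continuous_on continuous_on_subset ball_subset_cball)
  then show "isCont f x" by (rule continuous_on_interior) simp
qed

lemma lipschitz_on_balls_uniform:
  fixes V :: "'d::finite \<Rightarrow> 'a::real_normed_vector \<Rightarrow> 'b::real_normed_vector"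
  assumes "\<And>i. lipschitz_on_balls (V i)"
  obtains K where "\<And>i. K-lipschitz_on (cball 0 R) (V i)"
proof -
  have "\<exists>k. k-lipschitz_on (cball 0 R) (V i)" for i
    using assms unfolding lipschitz_on_balls_def by blast
  then obtain k where k: "\<And>i. (k i)-lipschitz_on (cball 0 R) (V i)" by metis
  have "(\<Sum>i\<in>UNIV. k i)-lipschitz_on (cball 0 R) (V i)" for i
  proof (rule lipschitz_on_le[OF k])
    show "k i \<le> (\<Sum>i\<in>UNIV. k i)"
      using k by (intro member_le_sum) (auto intro: lipschitz_on_nonneg)
  qed
  then show ?thesis by (rule that)
qed

text \<open>The quantifier order matters: \<open>M\<close> is chosen before the solutions, knowing
  only the radius \<open>R\<close> that bounds them. The horizon \<open>c\<close> may be shorter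
  than \<open>T\<close>, so that the estimate can be applied up to an exit time, and
  \<open>s\<close> and \<open>t\<close> are not ordered.\<close>

lemma cde_solution_stability:
  fixes V :: "'d::finite \<Rightarrow> real ^ 'n \<Rightarrow> real ^ 'n"
  assumes X: "C-lipschitz_on {0..T} X" and V: "\<And>i. lipschitz_on_balls (V i)"
  obtains M where "M > 0" "\<And>y y' Y Y' c s t. cde_solution V X T y Y \<Longrightarrow> cde_solution V X T y' Y' \<Longrightarrow>
      c \<le> T \<Longrightarrow> (\<And>r. r \<in> {0..c} \<Longrightarrow> norm (Y r) \<le> R \<and> norm (Y' r) \<le> R) \<Longrightarrow>
      s \<in> {0..c} \<Longrightarrow> t \<in> {0..c} \<Longrightarrow> norm (Y t - Y' t) \<le> M * norm (Y s - Y' s)"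
proof -
  obtain K where K: "\<And>i. K-lipschitz_on (cball 0 R) (V i)"
    by (rule lipschitz_on_balls_uniform[where V = V and R = R, OF V]) blast
  define k where "k = real CARD('d) * (3 * K * C)"
  have k: "k \<ge> 0"
    using lipschitz_on_nonneg[OF X] lipschitz_on_nonneg[OF K] by (simp add: k_def)
  obtain n :: nat where n: "2 * (k * T) \<le> real n" using real_arch_simple by blast
  have "norm (Y t - Y' t) \<le> 2 ^ (n + 1) * norm (Y s - Y' s)"
    if Y: "cde_solution V X T y Y" and Y': "cde_solution V X T y' Y'" and c: "c \<le> T"
      and R: "\<And>r. r \<in> {0..c} \<Longrightarrow> norm (Y r) \<le> R \<and> norm (Y' r) \<le> R"
      and st: "s \<in> {0..c}" "t \<in> {0..c}" for y y' Y Y' c s t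
  proof (rule two_sided_growth[where u = "\<lambda>r. Y r - Y' r" and K = k and a = 0 and b = c])
    show "continuous_on {0..c} (\<lambda>r. Y r - Y' r)"
      using Y Y' c unfolding cde_solution_def
      by (intro continuous_on_diff; auto elim!: continuous_on_subset)
    have "k * \<bar>t - s\<bar> \<le> k * T" using st c k by (intro mult_left_mono) auto
    then show "k * \<bar>t - s\<bar> \<le> (real n + 1) / 2" using n by simp
    fix s t B assume *: "0 \<le> s" "s \<le> t" "t \<le> c" "\<And>r. r \<in> {s..t} \<Longrightarrow> norm (Y r - Y' r) \<le> B"
    show "norm ((Y t - Y' t) - (Y s - Y' s)) \<le> k * (t - s) * B"
      unfolding k_def
      by (rule cde_solution_difference[OF Y Y' X lipschitz_on_balls_continuous[OF V] K])
        (use * c R in auto)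
  qed (use k st in auto)
  then show ?thesis by (intro that[of "2 ^ (n + 1)"]) auto
qed

text \<open>Injectivity in the initial value is stability read from \<open>t\<close> back to 0.
  Continuity is stability from 0 to \<open>t\<close>, but its constant presupposes a ball containing
  all nearby solutions; this is obtained by showing that they never get as far as distance 1 from
  the solution started at \<open>y\<close>.\<close>

lemma open_range_flow:
  fixes V :: "'d::finite \<Rightarrow> real ^ 'n \<Rightarrow> real ^ 'n"
  assumes X: "C-lipschitz_on {0..T} X" and V: "\<And>i. lipschitz_on_balls (V i)"
    and Y: "\<And>y. cde_solution V X T y (Y y)" and t: "t \<in> {0..T}"
  shows "open (range (\<lambda>y. Y y t))"
proof (rule invariance_of_domain)
  have T: "0 \<le> T" using t by simp
  have Y0: "Y y 0 = y" for y
    by (rule cde_solution_initial[OF Y X lipschitz_on_balls_continuous[OF V] T])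
  have cont: "continuous_on {0..T} (Y y)" for y using Y unfolding cde_solution_def by blast
  have bounded: "\<exists>R. \<forall>r\<in>{0..T}. norm (Y y r) \<le> R" for y
    using compact_imp_bounded[OF compact_continuous_image[OF cont compact_Icc]]
    unfolding bounded_iff by blast
  show "inj_on (\<lambda>y. Y y t) UNIV"
  proof (rule inj_onI)
    fix y y' assume eq: "Y y t = Y y' t"
    obtain R1 R2 where "\<forall>r\<in>{0..T}. norm (Y y r) \<le> R1" "\<forall>r\<in>{0..T}. norm (Y y' r) \<le> R2"
      using bounded by meson
    then have R: "norm (Y y r) \<le> max R1 R2 \<and> norm (Y y' r) \<le> max R1 R2" if "r \<in> {0..T}" for r
      using that by fastforce
    obtain M where M: "M > 0" "\<And>y y' Y Y' c s t. cde_solution V X T y Y \<Longrightarrow> cde_solution V X T y' Y' \<Longrightarrow>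
      c \<le> T \<Longrightarrow> (\<And>r. r \<in> {0..c} \<Longrightarrow> norm (Y r) \<le> max R1 R2 \<and> norm (Y' r) \<le> max R1 R2) \<Longrightarrow>
      s \<in> {0..c} \<Longrightarrow> t \<in> {0..c} \<Longrightarrow> norm (Y t - Y' t) \<le> M * norm (Y s - Y' s)"
      by (rule cde_solution_stability[where V = V and R = "max R1 R2", OF X V]) blast
    have "norm (Y y 0 - Y y' 0) \<le> M * norm (Y y t - Y y' t)"
      by (rule M(2)[OF Y Y order_refl R t]) (use T in auto)
    then show "y = y'" by (simp add: Y0 eq)
  qed
  show "continuous_on UNIV (\<lambda>y. Y y t)"
    unfolding continuous_on_iff
  proof (intro ballI allI impI)
    fix y \<epsilon> assume \<epsilon>: "(\<epsilon> :: real) > 0"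
    obtain R where R: "\<And>r. r \<in> {0..T} \<Longrightarrow> norm (Y y r) \<le> R" using bounded by blast
    obtain M where M: "M > 0" "\<And>y y' Y Y' c s t. cde_solution V X T y Y \<Longrightarrow> cde_solution V X T y' Y' \<Longrightarrow>
      c \<le> T \<Longrightarrow> (\<And>r. r \<in> {0..c} \<Longrightarrow> norm (Y r) \<le> R + 1 \<and> norm (Y' r) \<le> R + 1) \<Longrightarrow>
      s \<in> {0..c} \<Longrightarrow> t \<in> {0..c} \<Longrightarrow> norm (Y t - Y' t) \<le> M * norm (Y s - Y' s)"
      by (rule cde_solution_stability[where V = V and R = "R + 1", OF X V]) blast
    \<comment> \<open>The outer minimum starts the difference below 1; the quotient makes
      \<open>M\<close> times the initial difference smaller than both 1 and \<epsilon>.\<close>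
    define \<delta> where "\<delta> = min 1 (min 1 \<epsilon> / M)"
    have \<delta>: "\<delta> > 0" using \<epsilon> M(1) by (simp add: \<delta>_def)
    have "dist (Y y' t) (Y y t) < \<epsilon>" if y': "dist y' y < \<delta>" for y'
    proof -
      let ?u = "\<lambda>r. norm (Y y r - Y y' r)"
      have "norm (y - y') < 1" "norm (y - y') < min 1 \<epsilon> / M"
        using y' by (auto simp: \<delta>_def dist_norm norm_minus_commute)
      then have u0: "?u 0 < 1" "M * ?u 0 < 1" "M * ?u 0 < \<epsilon>"
        using M(1) by (auto simp: Y0 field_simps)
      have contu: "continuous_on {0..T} ?u" by (intro continuous_intros cont)
      have R': "norm (Y y r) \<le> R + 1 \<and> norm (Y y' r) \<le> R + 1" if "r \<in> {0..T}" "?u r \<le> 1" for r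
        using R[OF that(1)] that(2) norm_triangle_ineq2[of "Y y' r" "Y y r"]
        by (simp add: norm_minus_commute)
      have "?u r < 1" if r: "r \<in> {0..T}" for r
      proof (rule ccontr)
        assume "\<not> ?u r < 1"
        define Z where "Z = {0..T} \<inter> ?u -` {1..}"
        have "closed Z"
          unfolding Z_def by (intro continuous_closed_preimage contu) auto
        then have "compact Z"
          unfolding compact_eq_bounded_closed Z_def
          by (auto intro: bounded_subset[OF bounded_closed_interval])
        moreover have "Z \<noteq> {}" using \<open>\<not> ?u r < 1\<close> r by (auto simp: Z_def)
        ultimately obtain c where c: "c \<in> Z" "\<And>x. x \<in> Z \<Longrightarrow> c \<le> x"
          using compact_attains_inf by metis
        have c0: "0 \<le> c" "c \<le> T" "1 \<le> ?u c" using c by (auto simp: Z_def)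
        \<comment> \<open>By the intermediate value theorem the distance is exactly 1 at the first
          exit time \<open>c\<close> and at most 1 before it. Stability therefore applies on
          \<open>{0..c}\<close> and bounds this 1 by \<open>M * ?u 0\<close>, which is less than
          1.\<close>
        have "continuous_on {0..c} ?u" using c0 by (intro continuous_on_subset[OF contu]) auto
        then obtain x where x: "0 \<le> x" "x \<le> c" "?u x = 1"
          using IVT'[of ?u 0 1 c] u0(1) c0 by auto
        then have uc: "?u c = 1" using c(2)[of x] c0 by (auto simp: Z_def)
        have le1: "?u x \<le> 1" if "x \<in> {0..c}" for x
          using c(2)[of x] that uc c0 by (cases "x = c"; cases "1 \<le> ?u x") (auto simp: Z_def)
        have "?u c \<le> M * ?u 0"
          by (rule M(2)[OF Y Y c0(2)]) (use R' le1 c0 in auto)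
        then show False using u0 uc by simp
      qed
      then have "?u t \<le> M * ?u 0"
        by (intro M(2)[OF Y Y order_refl R']) (use t T in \<open>auto intro: less_imp_le\<close>)
      then show ?thesis using u0 by (simp add: dist_norm norm_minus_commute)
    qed
    then show "\<exists>d>0. \<forall>x'\<in>UNIV. dist x' y < d \<longrightarrow> dist (Y x' t) (Y y t) < \<epsilon>" using \<delta> by blast
  qed
qed simp

subsection \<open>Linear independence of double exponentials\<close>

lemma exp_exp_ratio_tendsto_0:
  fixes \<alpha> \<beta> p q :: real
  assumes "0 < \<alpha>" "0 < \<beta>" "0 < p" "p < q"
  shows "((\<lambda>x. exp (\<alpha> * exp (p * x) - \<beta> * exp (q * x))) \<longlongrightarrow> 0) at_top"
  using assms by real_asymp

text \<open>The relation is known only near 0, while the terms are separated by their growth at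
  infinity. The other terms are bounded by exp(|a_j| exp(|D_j| x)) regardless of signs and phases,
  which is why the absolute values of the \<open>D i\<close> have to be distinct.\<close>

lemma exp_exp_linear_independent:
  fixes w a D :: "'i \<Rightarrow> real"
  assumes fin: "finite I" and a: "\<And>i. i \<in> I \<Longrightarrow> a i \<noteq> 0" and D: "\<And>i. i \<in> I \<Longrightarrow> D i \<noteq> 0"
    and inj: "inj_on (\<lambda>i. \<bar>D i\<bar>) I" and \<epsilon>: "\<epsilon> > 0"
    and zero: "\<And>r. \<bar>r\<bar> < \<epsilon> \<Longrightarrow> (\<Sum>i\<in>I. w i * exp (a i * exp (D i * r))) = 0"
    and i: "i \<in> I"
  shows "w i = 0"
proof (rule ccontr)
  assume "w i \<noteq> 0"
  define E where "E j z = exp (of_real (a j) * exp (of_real (D j) * z))" for j and z :: complex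
  define F where "F z = (\<Sum>j\<in>I. of_real (w j) * E j z)" for z
  have F: "F z = 0" for z
  proof (rule analytic_continuation[where f = F and w = z and S = UNIV and \<xi> = 0 and U = "of_real ` {-\<epsilon><..<\<epsilon>}"])
    show "F holomorphic_on UNIV" unfolding F_def E_def by (intro holomorphic_intros)
    show "(0::complex) islimpt of_real ` {-\<epsilon><..<\<epsilon>}"
      unfolding islimpt_approachable
    proof (intro allI impI)
      fix e :: real assume e: "e > 0"
      have "complex_of_real (min \<epsilon> e / 2) \<in> of_real ` {-\<epsilon><..<\<epsilon>}"
        using e \<epsilon> by (intro imageI) auto
      moreover have "complex_of_real (min \<epsilon> e / 2) \<noteq> 0" using e \<epsilon> by simp
      moreover have "dist (complex_of_real (min \<epsilon> e / 2)) 0 < e"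
        using e \<epsilon> unfolding dist_0_norm[symmetric] dist_commute[of _ 0]
        by (simp add: norm_of_real del: of_real_divide)
      ultimately show "\<exists>x\<in>complex_of_real ` {-\<epsilon><..<\<epsilon>}. x \<noteq> 0 \<and> dist x 0 < e" by blast
    qed
    fix z :: complex assume "z \<in> of_real ` {-\<epsilon><..<\<epsilon>}"
    then obtain r where r: "z = of_real r" "\<bar>r\<bar> < \<epsilon>" by auto
    have "E j z = of_real (exp (a j * exp (D j * r)))" for j
      by (simp only: E_def r(1) exp_of_real flip: of_real_mult)
    then have "F z = of_real (\<Sum>i\<in>I. w i * exp (a i * exp (D i * r)))"
      by (simp add: F_def)
    then show "F z = 0" by (simp add: zero r(2))
  qed auto
  \<comment> \<open>Discarding zero weights first ensures that the dominant index \<open>m\<close>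
    has \<open>w m \<noteq> 0\<close>, which the limit will contradict.\<close>
  define J where "J = {j \<in> I. w j \<noteq> 0}"
  have J: "finite J" "i \<in> J" using fin i \<open>w i \<noteq> 0\<close> by (auto simp: J_def)
  obtain m where m: "m \<in> J" "\<And>j. j \<in> J \<Longrightarrow> \<bar>D j\<bar> \<le> \<bar>D m\<bar>"
  proof -
    have "Max ((\<lambda>j. \<bar>D j\<bar>) ` J) \<in> (\<lambda>j. \<bar>D j\<bar>) ` J" using J by (intro Max_in) auto
    then obtain m where "m \<in> J" "\<bar>D m\<bar> = Max ((\<lambda>j. \<bar>D j\<bar>) ` J)" by auto
    then show ?thesis using J by (intro that[of m]) auto
  qed
  have less: "\<bar>D j\<bar> < \<bar>D m\<bar>" if "j \<in> J - {m}" for j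
    using m(1) m(2)[of j] that inj_onD[OF inj, of j m] by (force simp: J_def)
  have Dm: "D m \<noteq> 0" using D m(1) by (simp add: J_def)
  \<comment> \<open>On this horizontal ray the term with the largest \<open>\<bar>D\<bar>\<close> grows with the full rate
    \<open>exp (\<bar>a\<bar> * exp (\<bar>D\<bar> * x))\<close>, whatever the sign of \<open>a\<close> is.\<close>
  define z where "z x = of_real (sgn (D m) * x) + (if a m > 0 then 0 else \<i> * of_real (pi / D m))" for x
  have Em: "cmod (E m (z x)) = exp (\<bar>a m\<bar> * exp (\<bar>D m\<bar> * x))" for x
  proof -
    have "of_real (D m) * z x = of_real (\<bar>D m\<bar> * x) + (if a m > 0 then 0 else \<i> * of_real pi)"
      using Dm by (simp add: z_def distrib_left abs_sgn flip: of_real_mult)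
    moreover have "exp (complex_of_real \<bar>D m\<bar> * of_real x) = of_real (exp (\<bar>D m\<bar> * x))"
      by (simp only: exp_of_real flip: of_real_mult)
    \<comment> \<open>The imaginary shift contributes exp(i pi) = -1 exactly when \<open>a m\<close>
      is negative, so the inner exponential carries the sign of \<open>a m\<close> and the outer
      exponent becomes positive.\<close>
    ultimately have "exp (of_real (D m) * z x) = of_real (sgn (a m) * exp (\<bar>D m\<bar> * x))"
      using a[of m] m(1) by (auto simp: exp_add J_def sgn_if)
    then have "E m (z x) = of_real (exp (a m * (sgn (a m) * exp (\<bar>D m\<bar> * x))))"
      unfolding E_def by (simp flip: exp_of_real)
    then show ?thesis by (simp add: abs_sgn mult.assoc)
  qed
  have Ej: "cmod (E j (z x)) \<le> exp (\<bar>a j\<bar> * exp (\<bar>D j\<bar> * x))" if "x \<ge> 0" for j x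
  proof -
    have "cmod (E j (z x)) = exp (Re (of_real (a j) * exp (of_real (D j) * z x)))"
      by (simp add: E_def)
    also have "Re (of_real (a j) * exp (of_real (D j) * z x)) \<le> cmod (of_real (a j) * exp (of_real (D j) * z x))"
      by (rule complex_Re_le_cmod)
    also have "\<dots> = \<bar>a j\<bar> * exp (D j * (sgn (D m) * x))"
      by (simp add: norm_mult z_def)
    also have "\<dots> \<le> \<bar>a j\<bar> * exp (\<bar>D j\<bar> * x)"
    proof -
      have "D j * sgn (D m) \<le> \<bar>D j\<bar>" by (auto simp: sgn_if)
      then have "D j * sgn (D m) * x \<le> \<bar>D j\<bar> * x" using that by (rule mult_right_mono)
      then show ?thesis by (intro mult_left_mono) (auto simp: mult.assoc)
    qed
    finally show ?thesis by simp
  qed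
  have bound: "\<bar>w m\<bar> \<le> (\<Sum>j\<in>J - {m}. \<bar>w j\<bar> * exp (\<bar>a j\<bar> * exp (\<bar>D j\<bar> * x) - \<bar>a m\<bar> * exp (\<bar>D m\<bar> * x)))"
    if "x \<ge> 0" for x
  proof -
    have "0 = (\<Sum>j\<in>J. of_real (w j) * E j (z x))"
      using F[of "z x"] fin unfolding F_def J_def
      by (subst (asm) sum.mono_neutral_right[where S = "{j \<in> I. w j \<noteq> 0}"]) auto
    also have "\<dots> = of_real (w m) * E m (z x) + (\<Sum>j\<in>J - {m}. of_real (w j) * E j (z x))"
      using J m by (intro sum.remove)
    finally have "of_real (w m) * E m (z x) = - (\<Sum>j\<in>J - {m}. of_real (w j) * E j (z x))"
      by (simp add: eq_neg_iff_add_eq_0)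
    then have "cmod (of_real (w m) * E m (z x)) = cmod (\<Sum>j\<in>J - {m}. of_real (w j) * E j (z x))"
      by simp
    also have "\<dots> \<le> (\<Sum>j\<in>J - {m}. \<bar>w j\<bar> * exp (\<bar>a j\<bar> * exp (\<bar>D j\<bar> * x)))"
      using Ej[OF that] by (intro sum_norm_le) (simp add: norm_mult mult_left_mono)
    finally have "\<bar>w m\<bar> * exp (\<bar>a m\<bar> * exp (\<bar>D m\<bar> * x)) \<le> \<dots>" by (simp add: norm_mult Em)
    then have "\<bar>w m\<bar> \<le> (\<Sum>j\<in>J - {m}. \<bar>w j\<bar> * exp (\<bar>a j\<bar> * exp (\<bar>D j\<bar> * x))) / exp (\<bar>a m\<bar> * exp (\<bar>D m\<bar> * x))"
      by (simp add: pos_le_divide_eq)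
    then show ?thesis by (simp add: sum_divide_distrib exp_diff)
  qed
  have "((\<lambda>x. \<Sum>j\<in>J - {m}. \<bar>w j\<bar> * exp (\<bar>a j\<bar> * exp (\<bar>D j\<bar> * x) - \<bar>a m\<bar> * exp (\<bar>D m\<bar> * x)))
      \<longlongrightarrow> (\<Sum>j\<in>J - {m}. \<bar>w j\<bar> * 0)) at_top"
    using a D m(1) less by (intro tendsto_sum tendsto_mult tendsto_const exp_exp_ratio_tendsto_0) (auto simp: J_def)
  then have "((\<lambda>x. \<Sum>j\<in>J - {m}. \<bar>w j\<bar> * exp (\<bar>a j\<bar> * exp (\<bar>D j\<bar> * x) - \<bar>a m\<bar> * exp (\<bar>D m\<bar> * x)))
      \<longlongrightarrow> 0) at_top"
    by simp
  moreover have "eventually (\<lambda>x. \<bar>w m\<bar> \<le> (\<Sum>j\<in>J - {m}. \<bar>w j\<bar> * exp (\<bar>a j\<bar> * exp (\<bar>D j\<bar> * x) - \<bar>a m\<bar> * exp (\<bar>D m\<bar> * x)))) at_top"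
    using eventually_ge_at_top[of 0] by eventually_elim (rule bound)
  ultimately have "\<bar>w m\<bar> \<le> 0"
    by (intro tendsto_lowerbound) auto
  then show False using m(1) by (simp add: J_def)
qed

lemma vector_field_component:
  assumes "\<And>k l. k \<noteq> l \<Longrightarrow> D $ k $ l = 0"
  shows "vector_field A D x $ j = exp (\<Sum>k\<in>UNIV. A $ j $ k * exp (D $ k $ k * x $ k))"
proof -
  have "(\<Sum>l\<in>UNIV. D $ k $ l * x $ l) = D $ k $ k * x $ k" for k
    using assms by (subst sum.remove[of UNIV k]) (auto intro!: sum.neutral)
  then show ?thesis by (simp add: vector_field_def vec_exp_def matrix_vector_mult_def)
qed

text \<open>A vector \<open>w\<close> orthogonal to the span is a linear relation between the
  functions V_i(x)_j on \<open>U\<close>. Since the \<open>D i\<close> are diagonal, moving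
  \<open>x\<close> along axis \<open>j\<close> changes only the summand with \<open>k = j\<close>,
  so the relation becomes one between double exponentials of a single variable.\<close>

lemma vector_fields_span:
  fixes A D :: "'d::finite \<Rightarrow> real ^ 'n ^ 'n"
  assumes diag: "\<And>i k l. k \<noteq> l \<Longrightarrow> D i $ k $ l = 0"
    and a: "\<And>i. A i $ j $ j \<noteq> 0" and D: "\<And>i. D i $ j $ j \<noteq> 0"
    and inj: "inj (\<lambda>i. \<bar>D i $ j $ j\<bar>)" and U: "open U" "U \<noteq> {}"
  shows "span ((\<lambda>x. \<chi> i. vector_field (A i) (D i) x $ j) ` U) = UNIV"
proof (rule ccontr)
  let ?v = "\<lambda>x. (\<chi> i. vector_field (A i) (D i) x $ j) :: real ^ 'd"
  assume "span (?v ` U) \<noteq> UNIV"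
  then obtain w where w: "w \<noteq> 0" and orth: "\<forall>u\<in>span (?v ` U). w \<bullet> u = 0"
    using span_not_UNIV_orthogonal by blast
  obtain x \<epsilon> where x: "x \<in> U" "\<epsilon> > 0" "ball x \<epsilon> \<subseteq> U" using U by (meson ex_in_conv openE)
  \<comment> \<open>\<open>c i\<close> is the positive factor frozen on the line;
    \<open>a' i\<close> absorbs the base point, which need not have
    \<open>x $ j = 0\<close>.\<close>
  define c where "c i = exp (\<Sum>k\<in>UNIV - {j}. A i $ j $ k * exp (D i $ k $ k * x $ k))" for i
  define a' where "a' i = A i $ j $ j * exp (D i $ j $ j * x $ j)" for i
  have "w $ i * c i = 0" for i
  proof (rule exp_exp_linear_independent[where I = UNIV and a = a' and D = "\<lambda>i. D i $ j $ j"])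
    fix r :: real assume r: "\<bar>r\<bar> < \<epsilon>"
    let ?x = "x + axis j r"
    have vf: "vector_field (A i) (D i) ?x $ j = c i * exp (a' i * exp (D i $ j $ j * r))" for i
    proof -
      have "(\<Sum>k\<in>UNIV. A i $ j $ k * exp (D i $ k $ k * ?x $ k)) =
          A i $ j $ j * exp (D i $ j $ j * ?x $ j) + (\<Sum>k\<in>UNIV - {j}. A i $ j $ k * exp (D i $ k $ k * ?x $ k))"
        by (rule sum.remove) auto
      also have "(\<Sum>k\<in>UNIV - {j}. A i $ j $ k * exp (D i $ k $ k * ?x $ k)) =
          (\<Sum>k\<in>UNIV - {j}. A i $ j $ k * exp (D i $ k $ k * x $ k))"
        by (intro sum.cong) (auto simp: axis_def)
      finally have "vector_field (A i) (D i) ?x $ j =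
          exp (A i $ j $ j * exp (D i $ j $ j * ?x $ j)) * c i"
        by (subst vector_field_component) (use diag in \<open>simp_all only: exp_add c_def\<close>)
      also have "exp (D i $ j $ j * ?x $ j) = exp (D i $ j $ j * x $ j) * exp (D i $ j $ j * r)"
        by (simp add: axis_def distrib_left exp_add)
      finally show ?thesis by (simp only: a'_def mult_ac)
    qed
    have "axis j r = r *\<^sub>R axis j 1" by (simp add: axis_def vec_eq_iff)
    then have "norm (axis j r) < \<epsilon>" using r by (simp add: norm_axis_1)
    then have "?x \<in> U" using x by (auto simp: dist_norm)
    then have "?v ?x \<in> span (?v ` U)" by (intro span_base imageI)
    then have "0 = w \<bullet> ?v ?x" using orth by simp
    also have "\<dots> = (\<Sum>i\<in>UNIV. w $ i * vector_field (A i) (D i) ?x $ j)" by (simp add: inner_vec_def)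
    finally show "(\<Sum>i\<in>UNIV. w $ i * c i * exp (a' i * exp (D i $ j $ j * r))) = 0"
      by (simp only: vf mult.assoc)
  qed (use a D inj x in \<open>auto simp: a'_def\<close>)
  then show False using w by (simp add: c_def vec_eq_iff)
qed

section \<open>Local Lipschitz bounds for the vector fields\<close>

lemma lipschitz_on_balls_compose:
  fixes f :: "'a::real_normed_vector \<Rightarrow> 'b::real_normed_vector" and g :: "'b \<Rightarrow> 'c::real_normed_vector"
  assumes f: "lipschitz_on_balls f" and g: "lipschitz_on_balls g"
  shows "lipschitz_on_balls (\<lambda>x. g (f x))"
  unfolding lipschitz_on_balls_def
proof
  fix R
  obtain K where K: "K-lipschitz_on (cball 0 R) f" using f unfolding lipschitz_on_balls_def by blast
  \<comment> \<open>By the Lipschitz bound relative to \<open>f 0\<close>, the ball of radius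
    \<open>R'\<close> contains the image of the ball of radius \<open>R\<close>.\<close>
  define R' where "R' = K * \<bar>R\<bar> + norm (f 0)"
  obtain K' where K': "K'-lipschitz_on (cball 0 R') g" using g unfolding lipschitz_on_balls_def by blast
  have "f ` cball 0 R \<subseteq> cball 0 R'"
  proof clarify
    fix x :: 'a assume x: "x \<in> cball 0 R"
    then have "0 \<in> cball (0::'a) R" using norm_ge_zero[of x] by (auto simp del: norm_ge_zero)
    then have "norm (f x - f 0) \<le> K * norm x" using lipschitz_onD[OF K x, of 0] by (simp add: dist_norm)
    also have "\<dots> \<le> K * \<bar>R\<bar>" using x lipschitz_on_nonneg[OF K] by (intro mult_left_mono) auto
    finally show "f x \<in> cball 0 R'" using norm_triangle_ineq2[of "f x" "f 0"] by (simp add: R'_def)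
  qed
  then have "(K' * K)-lipschitz_on (cball 0 R) (g \<circ> f)"
    using K K' by (intro lipschitz_on_compose lipschitz_on_subset[OF K'])
  then show "\<exists>C. C-lipschitz_on (cball 0 R) (\<lambda>x. g (f x))" by (auto simp: o_def)
qed

text \<open>Components on the ball are at most \<open>R\<close>, where the derivative of exp is at
  most \<open>exp R\<close>; the factor CARD('n) comes from estimating the Euclidean norm by the sum
  of the absolute components.\<close>

lemma lipschitz_on_balls_vec_exp: "lipschitz_on_balls (vec_exp :: real ^ 'n \<Rightarrow> _)"
  unfolding lipschitz_on_balls_def
proof
  fix R
  have "(real CARD('n) * exp R)-lipschitz_on (cball 0 R) (vec_exp :: real ^ 'n \<Rightarrow> _)"
  proof (rule lipschitz_onI)
    fix x y :: "real ^ 'n" assume "x \<in> cball 0 R" "y \<in> cball 0 R"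
    then have R: "x $ k \<le> R" "y $ k \<le> R" for k
      using component_le_norm_cart[of x k] component_le_norm_cart[of y k] by auto
    have exp_diff: "\<bar>exp s - exp t\<bar> \<le> exp R * \<bar>s - t\<bar>" if "s \<le> R" "t \<le> R" for s t :: real
    proof -
      have "norm (exp s - exp t) \<le> exp R * norm (s - t)"
        by (rule field_differentiable_bound[where S = "{..R}" and f' = exp])
          (use that in \<open>auto intro!: derivative_eq_intros\<close>)
      then show ?thesis by simp
    qed
    have "norm (vec_exp x - vec_exp y) \<le> (\<Sum>k\<in>UNIV. \<bar>exp (x $ k) - exp (y $ k)\<bar>)"
      using norm_le_l1_cart[of "vec_exp x - vec_exp y"] by (simp add: vec_exp_def)
    also have "\<dots> \<le> (\<Sum>k\<in>(UNIV :: 'n set). exp R * norm (x - y))"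
    proof (rule sum_mono)
      fix k
      have "\<bar>exp (x $ k) - exp (y $ k)\<bar> \<le> exp R * \<bar>(x - y) $ k\<bar>" using exp_diff R by simp
      also have "\<dots> \<le> exp R * norm (x - y)" by (intro mult_left_mono component_le_norm_cart) auto
      finally show "\<bar>exp (x $ k) - exp (y $ k)\<bar> \<le> exp R * norm (x - y)" .
    qed
    finally show "dist (vec_exp x) (vec_exp y) \<le> real CARD('n) * exp R * dist x y"
      by (simp add: dist_norm mult.assoc)
  qed simp
  then show "\<exists>C. C-lipschitz_on (cball 0 R) (vec_exp :: real ^ 'n \<Rightarrow> _)" by blast
qed

lemma lipschitz_on_balls_vector_field: "lipschitz_on_balls (vector_field A D)"
proof -
  have linear: "lipschitz_on_balls ((*v) B)" for B :: "real ^ 'n ^ 'n"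
    unfolding lipschitz_on_balls_def
    by (metis bounded_linear.lipschitz_boundE matrix_vector_mul_bounded_linear)
  show ?thesis
    unfolding vector_field_def[abs_def]
    by (intro lipschitz_on_balls_compose[OF _ lipschitz_on_balls_vec_exp]
        lipschitz_on_balls_compose[OF _ linear] linear)
qed

subsection \<open>The flow determines the increments of the driving path\<close>

text \<open>Equal flows mean that the same integrands, taken against \<open>X\<close> and against
  \<open>X'\<close>, produce the same increments. Freezing the integrand at time \<open>s\<close> in
  both turns this into a first-order statement about \<open>X - X'\<close> at every
  \<open>s\<close>, not just at almost every \<open>s\<close>.\<close>

lemma cde_flow_determines_increments:
  fixes V :: "'d::finite \<Rightarrow> real ^ 'n \<Rightarrow> real ^ 'n"
  assumes X: "C-lipschitz_on {0..T} X" and X': "C'-lipschitz_on {0..T} X'"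
    and V: "\<And>i. lipschitz_on_balls (V i)"
    and Y: "\<And>y. cde_solution V X T y (Y y)" and Y': "\<And>y. cde_solution V X' T y (Y' y)"
    and eq: "\<And>y t. t \<in> {0..T} \<Longrightarrow> Y y t = Y' y t"
    and span: "\<And>U. open U \<Longrightarrow> U \<noteq> {} \<Longrightarrow> span ((\<lambda>x. \<chi> i. V i x $ j) ` U) = UNIV"
  shows "\<exists>c. \<forall>t\<in>{0..T}. X t - X' t = c"
proof -
  define Z where "Z t = X t - X' t" for t
  let ?v = "\<lambda>x. \<chi> i. V i x $ j"
  note contV = lipschitz_on_balls_continuous[OF V]
  have v: "((\<lambda>t. ?v (Y y s) \<bullet> Z t) has_derivative (\<lambda>h. 0)) (at s within {0..T})"
    if s: "s \<in> {0..T}" for y s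
    unfolding has_derivative_within_alt
  proof (intro conjI allI impI)
    fix e :: real assume e: "e > 0"
    define k where "k = real CARD('d) * (C + C')"
    have k: "k \<ge> 0" using lipschitz_on_nonneg[OF X] lipschitz_on_nonneg[OF X'] by (simp add: k_def)
    define e' where "e' = e / (k + 1)"
    have e': "e' > 0" "e' * k \<le> e" using e k by (auto simp: e'_def field_simps)
    have "continuous_on {0..T} (\<lambda>r. \<chi> i. V i (Y y r))"
      using Y by (intro continuous_intros continuous_on_compose2[OF contV]) (auto simp: cde_solution_def)
    then obtain d where d: "d > 0" "\<And>r. r \<in> {0..T} \<Longrightarrow> dist r s < d \<Longrightarrow>
        dist (\<chi> i. V i (Y y r)) (\<chi> i. V i (Y y s)) < e'"
      using s e'(1) unfolding continuous_on_iff by meson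
    have close: "norm (V i (Y y r) - V i (Y y s)) \<le> e'" if "r \<in> {0..T}" "dist r s < d" for r i
      using d(2)[OF that] Finite_Cartesian_Product.norm_nth_le[of "(\<chi> i. V i (Y y r)) - (\<chi> i. V i (Y y s))" i]
      by (simp add: dist_norm)
    have "norm (?v (Y y s) \<bullet> Z t - ?v (Y y s) \<bullet> Z s - 0) \<le> e * norm (t - s)"
      if t: "t \<in> {0..T}" "norm (t - s) < d" for t
    proof -
      \<comment> \<open>The derivative is two-sided, whereas integrals are taken over intervals with
        ordered endpoints.\<close>
      define a b where "a = min s t" and "b = max s t"
      have ab: "0 \<le> a" "a \<le> b" "b \<le> T" "s \<in> {a..b}" "b - a = norm (t - s)"
        using s t by (auto simp: a_def b_def)
      have sub: "{a..b} \<subseteq> {0..T}" using ab by auto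
      have close': "norm (V i (Y y r) - V i (Y y s)) \<le> e'" if "r \<in> {a..b}" for r i
        using that s t by (intro close) (auto simp: a_def b_def dist_real_def)
      obtain J where J: "\<And>i. has_RS_integral (\<lambda>r. V i (Y y r)) (\<lambda>r. X r $ i) a b (J i)"
        "Y y b - Y y a = (\<Sum>i\<in>UNIV. J i)"
        using cde_solution_increment[OF Y X contV ab(1-3)] by blast
      obtain J' where J': "\<And>i. has_RS_integral (\<lambda>r. V i (Y' y r)) (\<lambda>r. X' r $ i) a b (J' i)"
        "Y' y b - Y' y a = (\<Sum>i\<in>UNIV. J' i)"
        using cde_solution_increment[OF Y' X' contV ab(1-3)] by blast
      have J'': "has_RS_integral (\<lambda>r. V i (Y y r)) (\<lambda>r. X' r $ i) a b (J' i)" for i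
        using J'(1)[of i] sub eq
          has_RS_integral_cong[of a b "\<lambda>r. V i (Y y r)" "\<lambda>r. V i (Y' y r)" "\<lambda>r. X' r $ i" "\<lambda>r. X' r $ i"]
        by auto
      have sumJ: "(\<Sum>i\<in>UNIV. J i) = (\<Sum>i\<in>UNIV. J' i)"
        using J(2) J'(2) eq[of a y] eq[of b y] ab by simp
      define E where "E i = (J' i - (X' b $ i - X' a $ i) *\<^sub>R V i (Y y s))
          - (J i - (X b $ i - X a $ i) *\<^sub>R V i (Y y s))" for i
      have E: "norm (E i) \<le> e' * (C + C') * (b - a)" for i
      proof -
        have "norm (J i - (X b $ i - X a $ i) *\<^sub>R V i (Y y s)) \<le> e' * (C * (b - a))"
          by (rule has_RS_integral_approx[OF J(1) ab(4) lipschitz_on_subset[OF lipschitz_on_component[OF X] sub] close'])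
        moreover have "norm (J' i - (X' b $ i - X' a $ i) *\<^sub>R V i (Y y s)) \<le> e' * (C' * (b - a))"
          by (rule has_RS_integral_approx[OF J'' ab(4) lipschitz_on_subset[OF lipschitz_on_component[OF X'] sub] close'])
        moreover have "norm (E i) \<le> norm (J' i - (X' b $ i - X' a $ i) *\<^sub>R V i (Y y s))
            + norm (J i - (X b $ i - X a $ i) *\<^sub>R V i (Y y s))"
          unfolding E_def by (rule norm_triangle_ineq4)
        moreover have "e' * (C + C') * (b - a) = e' * (C' * (b - a)) + e' * (C * (b - a))" by algebra
        ultimately show ?thesis by linarith
      qed
      have "E i = J' i - J i + (Z b - Z a) $ i *\<^sub>R V i (Y y s)" for i
        by (simp add: E_def Z_def algebra_simps)
      then have "(\<Sum>i\<in>UNIV. E i) = (\<Sum>i\<in>UNIV. (Z b - Z a) $ i *\<^sub>R V i (Y y s))"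
        using sumJ by (simp add: sum.distrib sum_subtractf)
      then have "(\<Sum>i\<in>UNIV. E i) $ j = ?v (Y y s) \<bullet> (Z b - Z a)"
        by (simp add: inner_vec_def mult.commute)
      then have "\<bar>?v (Y y s) \<bullet> (Z b - Z a)\<bar> \<le> norm (\<Sum>i\<in>UNIV. E i)"
        by (metis component_le_norm_cart)
      also have "\<dots> \<le> (\<Sum>i\<in>(UNIV :: 'd set). e' * (C + C') * (b - a))" by (intro sum_norm_le E)
      also have "\<dots> = (e' * k) * (b - a)" by (simp add: k_def)
      also have "\<dots> \<le> e * (b - a)" using e'(2) ab by (intro mult_right_mono) auto
      finally have "\<bar>?v (Y y s) \<bullet> (Z b - Z a)\<bar> \<le> e * norm (t - s)" using ab(5) by simp
      moreover have "\<bar>?v (Y y s) \<bullet> (Z b - Z a)\<bar> = \<bar>?v (Y y s) \<bullet> Z t - ?v (Y y s) \<bullet> Z s\<bar>"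
        by (cases "s \<le> t") (simp_all add: a_def b_def inner_diff_right max_def min_def abs_minus_commute)
      ultimately show ?thesis by simp
    qed
    then show "\<exists>d>0. \<forall>t\<in>{0..T}. norm (t - s) < d \<longrightarrow>
        norm (?v (Y y s) \<bullet> Z t - ?v (Y y s) \<bullet> Z s - 0) \<le> e * norm (t - s)"
      using d(1) by blast
  qed simp
  \<comment> \<open>The test vectors \<open>?v (Y y s)\<close> change with \<open>s\<close>.
    Therefore \<open>u\<close> is fixed first and, at each \<open>s\<close>, expressed through the
    vectors available there; the derivative of \<open>u \<bullet> Z t\<close> then vanishes at every
    \<open>s\<close>.\<close>
  have "\<exists>c. \<forall>t\<in>{0..T}. u \<bullet> Z t = c" for u
  proof (rule has_derivative_zero_constant)
    fix s assume s: "s \<in> {0..T}"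
    have "open (range (\<lambda>y. Y y s))" by (rule open_range_flow[OF X V Y s])
    then have "u \<in> span (?v ` range (\<lambda>y. Y y s))" using span by blast
    then show "((\<lambda>t. u \<bullet> Z t) has_derivative (\<lambda>h. 0)) (at s within {0..T})"
    proof (rule span_induct)
      show "subspace {u. ((\<lambda>t. u \<bullet> Z t) has_derivative (\<lambda>h. 0)) (at s within {0..T})}"
      proof (rule subspaceI; clarsimp simp: inner_add_left)
        show "((\<lambda>t. x \<bullet> Z t + y \<bullet> Z t) has_derivative (\<lambda>h. 0)) (at s within {0..T})"
          if "((\<lambda>t. x \<bullet> Z t) has_derivative (\<lambda>h. 0)) (at s within {0..T})"
            "((\<lambda>t. y \<bullet> Z t) has_derivative (\<lambda>h. 0)) (at s within {0..T})" for x y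
          using has_derivative_add[OF that] by simp
        show "((\<lambda>t. c * (x \<bullet> Z t)) has_derivative (\<lambda>h. 0)) (at s within {0..T})"
          if "((\<lambda>t. x \<bullet> Z t) has_derivative (\<lambda>h. 0)) (at s within {0..T})" for c x
          using has_derivative_mult_right[OF that, of c] by simp
      qed
    qed (use v[OF s] in auto)
  qed simp
  then obtain c where c: "\<And>u t. t \<in> {0..T} \<Longrightarrow> u \<bullet> Z t = c u" by metis
  have "Z t = (\<chi> i. c (axis i 1))" if "t \<in> {0..T}" for t
    using c[OF that, of "axis _ 1"] by (simp add: vec_eq_iff inner_axis' )
  then show ?thesis unfolding Z_def by blast
qed

subsection \<open>Genericity of the sampled coefficients\<close>

lemma AE_notin_finite:
  assumes "absolutely_continuous lborel \<mu>" "finite (S :: real set)"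
  shows "AE x in \<mu>. x \<notin> S"
  using assms unfolding absolutely_continuous_def
  by (intro AE_not_in) (auto intro: finite_imp_null_set_lborel)

text \<open>Independence makes the joint law a product measure. For a fixed first coordinate x the
  excluded second coordinates are x and -x, a finite and hence null set, so Fubini applies.\<close>

lemma (in prob_space) indep_vars_AE_abs_neq:
  fixes Z :: "'i \<Rightarrow> 'a \<Rightarrow> real"
  assumes ind: "indep_vars (\<lambda>_. borel) Z UNIV" and distr: "\<And>e. distr M borel (Z e) = \<mu>"
    and ac: "absolutely_continuous lborel \<mu>" and ne: "e \<noteq> e'"
  shows "AE \<omega> in M. \<bar>Z e \<omega>\<bar> \<noteq> \<bar>Z e' \<omega>\<bar>"
proof -
  have rv [measurable]: "Z i \<in> borel_measurable M" for i
    using ind unfolding indep_vars_def by auto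
  have \<mu> [measurable_cong]: "sets \<mu> = sets borel" using distr[of e] by (metis sets_distr)
  \<comment> \<open>Independence of the pair is extracted by restricting the family to the disjoint
    index sets \<open>{e}\<close> and \<open>{e'}\<close> and then projecting.\<close>
  have "indep_var (PiM {e} (\<lambda>_. borel)) (\<lambda>\<omega>. restrict (\<lambda>i. Z i \<omega>) {e})
      (PiM {e'} (\<lambda>_. borel)) (\<lambda>\<omega>. restrict (\<lambda>i. Z i \<omega>) {e'})"
    using ne by (intro indep_var_restrict[OF ind]) auto
  then have "indep_var borel ((\<lambda>f. f e) \<circ> (\<lambda>\<omega>. restrict (\<lambda>i. Z i \<omega>) {e}))
      borel ((\<lambda>f. f e') \<circ> (\<lambda>\<omega>. restrict (\<lambda>i. Z i \<omega>) {e'}))"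
    by (rule indep_var_compose) (auto intro!: measurable_component_singleton)
  then have "indep_var borel (Z e) borel (Z e')" by (simp add: o_def)
  then have joint: "\<mu> \<Otimes>\<^sub>M \<mu> = distr M (borel \<Otimes>\<^sub>M borel) (\<lambda>\<omega>. (Z e \<omega>, Z e' \<omega>))"
    unfolding indep_var_distribution_eq by (simp add: distr)
  interpret \<mu>: prob_space \<mu>
    using prob_space_distr[OF rv[of e]] by (simp add: distr)
  interpret P: pair_sigma_finite \<mu> \<mu> ..
  have "AE z in \<mu> \<Otimes>\<^sub>M \<mu>. \<bar>fst z\<bar> \<noteq> \<bar>snd z\<bar>"
  proof (rule P.AE_pair_measure)
    show "{z \<in> space (\<mu> \<Otimes>\<^sub>M \<mu>). \<bar>fst z\<bar> \<noteq> \<bar>snd z\<bar>} \<in> sets (\<mu> \<Otimes>\<^sub>M \<mu>)" by measurable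
    have "AE y in \<mu>. \<bar>x\<bar> \<noteq> \<bar>y\<bar>" for x
      using AE_notin_finite[OF ac, of "{x, -x}"] by (rule AE_mp) (auto simp: abs_eq_iff)
    then show "AE x in \<mu>. AE y in \<mu>. \<bar>fst (x, y)\<bar> \<noteq> \<bar>snd (x, y)\<bar>" by simp
  qed
  then show ?thesis unfolding joint by (subst (asm) AE_distr_iff) auto
qed

lemma (in prob_space) AE_generic_coefficients:
  fixes A D :: "'d::finite \<Rightarrow> 'a \<Rightarrow> real ^ 'n::finite ^ 'n"
  assumes ind: "indep_vars (\<lambda>_. borel) (sampled_entry A D) UNIV"
    and distr: "\<And>e. distr M borel (sampled_entry A D e) = \<mu>"
    and ac: "absolutely_continuous lborel \<mu>"
  shows "AE \<omega> in M. (\<forall>i. A i \<omega> $ j $ j \<noteq> 0) \<and> (\<forall>i. D i \<omega> $ j $ j \<noteq> 0) \<and> inj (\<lambda>i. \<bar>D i \<omega> $ j $ j\<bar>)"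
proof -
  have rv: "sampled_entry A D e \<in> borel_measurable M" for e
    using ind unfolding indep_vars_def by auto
  have nonzero: "AE \<omega> in M. sampled_entry A D e \<omega> \<noteq> 0" for e
  proof -
    have "AE x in distr M borel (sampled_entry A D e). x \<noteq> 0"
      using AE_notin_finite[OF ac, of "{0}"] unfolding distr by simp
    then show ?thesis by (subst (asm) AE_distr_iff) (auto simp: rv)
  qed
  have "AE \<omega> in M. \<forall>i\<in>UNIV. A i \<omega> $ j $ j \<noteq> 0"
    by (rule AE_finite_allI) (use nonzero[of "Inl (_, j, j)"] in auto)
  moreover have "AE \<omega> in M. \<forall>i\<in>UNIV. D i \<omega> $ j $ j \<noteq> 0"
    by (rule AE_finite_allI) (use nonzero[of "Inr (_, j)"] in auto)
  moreover have "AE \<omega> in M. \<forall>p\<in>{p :: 'd \<times> 'd. fst p \<noteq> snd p}. \<bar>D (fst p) \<omega> $ j $ j\<bar> \<noteq> \<bar>D (snd p) \<omega> $ j $ j\<bar>"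
  proof (rule AE_finite_allI)
    fix p :: "'d \<times> 'd" assume "p \<in> {p. fst p \<noteq> snd p}"
    then show "AE \<omega> in M. \<bar>D (fst p) \<omega> $ j $ j\<bar> \<noteq> \<bar>D (snd p) \<omega> $ j $ j\<bar>"
      using indep_vars_AE_abs_neq[OF ind distr ac, of "Inr (fst p, j)" "Inr (snd p, j)"] by simp
  qed simp
  ultimately show ?thesis by eventually_elim (auto simp: inj_def)
qed

theorem mainTheorem4:
  fixes M :: "'a measure" and \<mu> :: "real measure"
    and A D :: "'d::finite \<Rightarrow> 'a \<Rightarrow> real ^ 'n::finite ^ 'n"
    and L :: nat and T :: real
  assumes "L \<ge> 1" and "CARD('n) \<ge> L - 1" and "T > 0"
    and "prob_space M"
    and diagonal: "\<And>i \<omega> j k. \<omega> \<in> space M \<Longrightarrow> j \<noteq> k \<Longrightarrow> D i \<omega> $ j $ k = 0"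
    and independent: "prob_space.indep_vars M (\<lambda>_. borel) (sampled_entry A D) UNIV"
    and distribution: "\<And>e. distr M borel (sampled_entry A D e) = \<mu>"
    and abs_cont: "absolutely_continuous lborel \<mu>"
  shows "AE \<omega> in M.
    \<forall>(X :: real \<Rightarrow> real ^ 'd) (X' :: real \<Rightarrow> real ^ 'd)
     (Y :: real ^ 'n \<Rightarrow> real \<Rightarrow> real ^ 'n) (Y' :: real ^ 'n \<Rightarrow> real \<Rightarrow> real ^ 'n).
      (\<exists>C. C-lipschitz_on {0..T} X) \<and> (\<exists>C. C-lipschitz_on {0..T} X') \<and>
      (\<forall>y. cde_unique_solution (\<lambda>i. vector_field (A i \<omega>) (D i \<omega>)) X T y (Y y)) \<and>
      (\<forall>y. cde_unique_solution (\<lambda>i. vector_field (A i \<omega>) (D i \<omega>)) X' T y (Y' y)) \<and>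
      (\<forall>y. \<forall>t\<in>{0..T}. Y y t = Y' y t)
      \<longrightarrow> (\<forall>w s t. length w \<le> L \<and> 0 \<le> s \<and> s \<le> t \<and> t \<le> T
            \<longrightarrow> iterated_integral X w s t = iterated_integral X' w s t)"
proof -
  interpret prob_space M by fact
  \<comment> \<open>Any coordinate serves, since the genericity statement below holds for each
    \<open>j\<close>.\<close>
  define j :: 'n where "j = undefined"
  \<comment> \<open>The exceptional event is described by the coefficients alone, so a single null
    set serves all paths and solutions simultaneously. \<open>AE_space\<close> is added because
    \<open>diagonal\<close> speaks only of points of \<open>space M\<close>.\<close>
  have "AE \<omega> in M. (\<forall>i. A i \<omega> $ j $ j \<noteq> 0) \<and> (\<forall>i. D i \<omega> $ j $ j \<noteq> 0) \<and> inj (\<lambda>i. \<bar>D i \<omega> $ j $ j\<bar>)"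
    by (rule AE_generic_coefficients[OF independent distribution abs_cont])
  then show ?thesis
    using AE_space
  proof eventually_elim
    case (elim \<omega>)
    let ?V = "\<lambda>i. vector_field (A i \<omega>) (D i \<omega>)"
    have span: "span ((\<lambda>x. \<chi> i. ?V i x $ j) ` U) = UNIV" if "open U" "U \<noteq> {}" for U
      using elim that by (intro vector_fields_span diagonal) auto
    show ?case
    proof (intro allI impI, elim conjE exE)
      fix X X' Y Y' w s t C C'
      assume X: "C-lipschitz_on {0..T} X" "C'-lipschitz_on {0..T} X'"
        and Y: "\<forall>y. cde_unique_solution ?V X T y (Y y)" "\<forall>y. cde_unique_solution ?V X' T y (Y' y)"
        and eq: "\<forall>y. \<forall>t\<in>{0..T}. Y y t = Y' y t" and st: "0 \<le> s" "s \<le> t" "t \<le> T"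
      have "\<exists>c. \<forall>t\<in>{0..T}. X t - X' t = c"
        using Y eq
        by (intro cde_flow_determines_increments[OF X lipschitz_on_balls_vector_field _ _ _ span,
            where Y = Y and Y' = Y']) (auto simp: cde_unique_solution_def)
      then obtain c where "\<And>r. r \<in> {0..T} \<Longrightarrow> X r = c + X' r" by (metis diff_add_cancel)
      then show "iterated_integral X w s t = iterated_integral X' w s t"
        unfolding iterated_integral_def using st by (intro iterated_integral_rev_cong) auto
    qed
  qed
qed

end
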